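(* Let $F$ be a Markov multi-map of $[0,1]$ belonging to the class $\mathcal{F}$, with trajectory space $X$ and associated shift of finite type $\Sigma_M$. Then $h_{top}(X,\sigma_X)=h_{top}(\Sigma_M,\sigma_M)$, where $h_{top}$ denotes topological entropy.
   Context: **Markov multi-maps.** A Markov multi-map $F$ of $[0,1]$ is defined by a tuple $(P,\mathcal{A}_0,\mathcal{A}_1,\mathcal{A}_2,D,R,\{f_a\}_{a\in\mathcal{A}_0})$ such that: (1) $P=\{p_0,\dots,p_r\}$ with $0=p_0<\dots<p_r=1$; (2) $\mathcal{A}=\mathcal{A}_0\sqcup\mathcal{A}_1\sqcup\mathcal{A}_2$ is a finite set; (3) $D$ assigns to each $a\in\mathcal{A}$ a closed set $D(a)$, where for some $i$, $D(a)=[p_i,p_{i+1}]$ if $a\in\mathcal{A}_0$ and $D(a)=\{p_i\}$ if $a\in\mathcal{A}_1\cup\mathcal{A}_2$; (4) $R$ assigns to each $a\in\mathcal{A}$ a set $R(a)=[u,v]$ with $u\le v$ in $P$, where $u<v$ if $a\in\mathcal{A}_0$; $u<v$ and $R(a)\cap P=\{u,v\}$ if $a\in\mathcal{A}_1$; $u=v$ if $a\in\mathcal{A}_2$; (5) for $a\in\mathcal{A}_0$, $f_a:D(a)\to R(a)$ is a homeomorphism; (6) $[0,1]\subset\bigcup_{a\in\mathcal{A}}D(a)$. **Graphs.** For $a\in\mathcal{A}_0$, $G(a)$ is the graph of $f_a$; for $a\in\mathcal{A}_1\cup\mathcal{A}_2$, $G(a)=D(a)\times R(a)$. $G(F)=\bigcup_{a\in\mathcal{A}}G(a)$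 and $F(x)=\{y:(x,y)\in G(F)\}$. For $a\in\mathcal{A}_0$ with $D(a)=[p_i,p_{i+1}]$, $R(a)=[u,v]$: $D_0(a)=(p_i,p_{i+1})$, $R_0(a)=(u,v)$, and $G_0(a)$ is the graph of $f_a|_{D_0(a)}$. For $a\in\mathcal{A}_1$ with $D(a)=\{p\}$, $R(a)=[u,v]$: $D_0(a)=\{p\}$, $R_0(a)=(u,v)$, $G_0(a)=\{p\}\times(u,v)$. For $a\in\mathcal{A}_2$ with $D(a)=\{p\}$, $R(a)=\{q\}$: $D_0(a)=\{p\}$, $R_0(a)=\{q\}$, $G_0(a)=\{(p,q)\}$. $F$ is *properly parametrized* if the sets $G_0(a)$, $a\in\mathcal{A}$, form a partition of $G(F)$ (disjoint for distinct $a$, with union $G(F)$). **Trajectory space.** $X=\{(x_n)_{n\ge0}\in[0,1]^{\mathbb{Z}_+}: x_{n+1}\in F(x_n)\ \forall n\ge 0\}$ with the product topology; $\sigma_X$ is the left shift on $X$. **Associated SFT.** $M$ is the $0$-$1$ matrix indexed by $\mathcal{A}$ with $M(a,b)=1$ iff $D_0(b)\subset R_0(a)$. $\Sigma_M=\{\mathbf{a}\in\mathcal{A}^{\mathbb{Z}_+}: M(a_n,a_{n+1})=1\ \forall n\ge 0\}$, with left shift $\sigma_M$. $\mathcal{L}_n$ is the set of words $a_0\dots a_n\in\mathcal{A}^{n+1}$ with $M(a_i,a_{i+1})=1$ for $0\le i<n$; $\mathcal{L}=\bigcup_{n\ge0}\mathcal{L}_n$; $[u]$ denotes the set of points of $\Sigma_M$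 beginning with the word $u$. The irreducible components $\mathcal{C}\subset\mathcal{A}$ are the vertex sets of the maximal strongly connected components of the directed graph with adjacency matrix $M$; $\Sigma_M(\mathcal{C})$ is the set of points of $\Sigma_M$ using only symbols of $\mathcal{C}$, $\mathcal{L}(\mathcal{C})$ is the set of words in $\mathcal{L}$ using only symbols of $\mathcal{C}$, and $\mathcal{C}$ has positive entropy if $\Sigma_M(\mathcal{C})$ has positive topological entropy. **Intervals.** For $a\in\mathcal{A}_0$, $f_a^{-1}:R(a)\to D(a)$ is the inverse of $f_a$; for $a\in\mathcal{A}_1\cup\mathcal{A}_2$, $f_a^{-1}:R(a)\to D(a)$ is the unique (constant) map. For $a_0\dots a_n\in\mathcal{L}_n$, $I_{a_0\dots a_n}=f_{a_0}^{-1}\circ\dots\circ f_{a_{n-1}}^{-1}(D(a_n))$; for $\mathbf{a}\in\Sigma_M$, $I_{\mathbf{a}}=\bigcap_{n\ge1}I_{a_0\dots a_n}$. **Class $\mathcal{F}$.** A *coding word* for a component $\mathcal{C}$ is $u\in\mathcal{L}(\mathcal{C})$ such that if $\mathbf{a}\in\Sigma_M(\mathcal{C})$ and $\{n\ge0:\sigma_M^n(\mathbf{a})\in[u]\}$ is infinite, then $I_{\mathbf{a}}$ is a singleton. An *avoiding word* for $\mathcal{C}$ is $u\in\mathcal{L}(\mathcal{C})$ such that $\mathbf{a}\in[u]$ implies $I_{\mathbf{a}}\cap P=\varnothing$. $\mathcal{F}$ is the class of all properly parametrized Markov multi-maps such that every irreducible component with positive entropy has a coding word, every irreducible component with positive entropy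 contained in $\mathcal{A}_0$ has an avoiding word, and $\Sigma_M$ has positive topological entropy. *)

theory Defs
  imports "Graph_Theory.Digraph_Component" "HOL-Analysis.Analysis"
begin

section \<open>Topological entropy\<close>

definition open_cover :: "'x topology \<Rightarrow> 'x set set \<Rightarrow> bool" where
  "open_cover T \<U> \<longleftrightarrow> (\<forall>U\<in>\<U>. openin T U) \<and> \<Union>\<U> = topspace T"

text \<open>The common refinement of the covers \<open>(f ^^ i) -` \<U>\<close> for \<open>i < n\<close>.\<close>

definition iterated_cover :: "'x topology \<Rightarrow> ('x \<Rightarrow> 'x) \<Rightarrow> 'x set set \<Rightarrow> nat \<Rightarrow> 'x set set" where
  "iterated_cover T f \<U> n =
     {{x \<in> topspace T. \<forall>i<n. (f ^^ i) x \<in> g i} | g. \<forall>i<n. g i \<in> \<U>}"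

definition min_subcover_card :: "'x topology \<Rightarrow> 'x set set \<Rightarrow> nat" where
  "min_subcover_card T \<U> =
     (LEAST k. \<exists>\<V>. \<V> \<subseteq> \<U> \<and> finite \<V> \<and> card \<V> = k \<and> \<Union>\<V> = topspace T)"

text \<open>
  Entropy by open covers (Adler, Konheim, McAndrew), for a continuous self-map \<open>f\<close> of a compact
  space \<open>T\<close>. The limit superior is a limit, by subadditivity. The empty space gets entropy 0,
  because \<open>ln 0 = 0\<close>.
\<close>

definition cover_entropy :: "'x topology \<Rightarrow> ('x \<Rightarrow> 'x) \<Rightarrow> 'x set set \<Rightarrow> ereal" where
  "cover_entropy T f \<U> =
     limsup (\<lambda>n. ereal (ln (real (min_subcover_card T (iterated_cover T f \<U> n))) / real n))"

definition topological_entropy :: "'x topology \<Rightarrow> ('x \<Rightarrow> 'x) \<Rightarrow> ereal" where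
  "topological_entropy T f = (SUP \<U>\<in>{\<U>. open_cover T \<U>}. cover_entropy T f \<U>)"

definition left_shift :: "(nat \<Rightarrow> 'x) \<Rightarrow> nat \<Rightarrow> 'x" where
  "left_shift x = (\<lambda>n. x (Suc n))"


section \<open>Markov multi-maps\<close>

text \<open>
  The partition is \<open>pt 0 < \<dots> < pt npts\<close>; values of \<open>pt\<close> beyond \<open>npts\<close>, of \<open>Dset\<close> and \<open>Rset\<close> outside
  the alphabet, and of \<open>branch a\<close> outside \<open>Dset a\<close> are irrelevant.
\<close>

record 'a multimap_data =
  npts :: nat
  pt :: "nat \<Rightarrow> real"
  alph0 :: "'a set"
  alph1 :: "'a set"
  alph2 :: "'a set"
  Dset :: "'a \<Rightarrow> real set"
  Rset :: "'a \<Rightarrow> real set"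
  branch :: "'a \<Rightarrow> real \<Rightarrow> real"

definition Pset :: "'a multimap_data \<Rightarrow> real set" where
  "Pset F = pt F ` {0..npts F}"

definition alph :: "'a multimap_data \<Rightarrow> 'a set" where
  "alph F = alph0 F \<union> alph1 F \<union> alph2 F"

definition markov_multimap :: "'a multimap_data \<Rightarrow> bool" where
  "markov_multimap F \<longleftrightarrow>
     pt F 0 = 0 \<and> pt F (npts F) = 1 \<and> strict_mono_on {0..npts F} (pt F) \<and>
     finite (alph F) \<and>
     alph0 F \<inter> alph1 F = {} \<and> alph0 F \<inter> alph2 F = {} \<and> alph1 F \<inter> alph2 F = {} \<and>
     (\<forall>a\<in>alph0 F. \<exists>i<npts F. Dset F a = {pt F i..pt F (Suc i)}) \<and>
     (\<forall>a\<in>alph1 F \<union> alph2 F. \<exists>i\<le>npts F. Dset F a = {pt F i}) \<and>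
     (\<forall>a\<in>alph0 F. \<exists>u\<in>Pset F. \<exists>v\<in>Pset F. u < v \<and> Rset F a = {u..v}) \<and>
     (\<forall>a\<in>alph1 F. \<exists>u\<in>Pset F. \<exists>v\<in>Pset F. u < v \<and> Rset F a = {u..v} \<and>
        Rset F a \<inter> Pset F = {u, v}) \<and>
     (\<forall>a\<in>alph2 F. \<exists>u\<in>Pset F. Rset F a = {u}) \<and>
     (\<forall>a\<in>alph0 F. \<exists>g. homeomorphism (Dset F a) (Rset F a) (branch F a) g) \<and>
     {0..1} \<subseteq> (\<Union>a\<in>alph F. Dset F a)"


subsection \<open>Graphs\<close>

definition graph_of :: "'a multimap_data \<Rightarrow> 'a \<Rightarrow> (real \<times> real) set" where
  "graph_of F a =
     (if a \<in> alph0 F then {(x, branch F a x) | x. x \<in> Dset F a} else Dset F a \<times> Rset F a)"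

definition multimap_graph :: "'a multimap_data \<Rightarrow> (real \<times> real) set" where
  "multimap_graph F = (\<Union>a\<in>alph F. graph_of F a)"

definition multimap_image :: "'a multimap_data \<Rightarrow> real \<Rightarrow> real set" where
  "multimap_image F x = {y. (x, y) \<in> multimap_graph F}"

text \<open>The interior of \<open>{u..v}\<close> is the open interval \<open>{u<..<v}\<close>.\<close>

definition D0 :: "'a multimap_data \<Rightarrow> 'a \<Rightarrow> real set" where
  "D0 F a = (if a \<in> alph0 F then interior (Dset F a) else Dset F a)"

definition R0 :: "'a multimap_data \<Rightarrow> 'a \<Rightarrow> real set" where
  "R0 F a = (if a \<in> alph0 F \<union> alph1 F then interior (Rset F a) else Rset F a)"

definition graph0_of :: "'a multimap_data \<Rightarrow> 'a \<Rightarrow> (real \<times> real) set" where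
  "graph0_of F a =
     (if a \<in> alph0 F then {(x, branch F a x) | x. x \<in> D0 F a} else D0 F a \<times> R0 F a)"

definition properly_parametrized :: "'a multimap_data \<Rightarrow> bool" where
  "properly_parametrized F \<longleftrightarrow>
     (\<forall>a\<in>alph F. \<forall>b\<in>alph F. a \<noteq> b \<longrightarrow> graph0_of F a \<inter> graph0_of F b = {}) \<and>
     (\<Union>a\<in>alph F. graph0_of F a) = multimap_graph F"


subsection \<open>Trajectory space\<close>

definition trajectories :: "'a multimap_data \<Rightarrow> (nat \<Rightarrow> real) set" where
  "trajectories F = {x. (\<forall>n. x n \<in> {0..1}) \<and> (\<forall>n. x (Suc n) \<in> multimap_image F (x n))}"

definition trajectory_space :: "'a multimap_data \<Rightarrow> (nat \<Rightarrow> real) topology" where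
  "trajectory_space F =
     subtopology (product_topology (\<lambda>_. top_of_set {0..1}) UNIV) (trajectories F)"


subsection \<open>Associated shift of finite type\<close>

definition transition :: "'a multimap_data \<Rightarrow> 'a \<Rightarrow> 'a \<Rightarrow> nat" where
  "transition F a b = (if D0 F b \<subseteq> R0 F a then 1 else 0)"

definition sft :: "'a multimap_data \<Rightarrow> (nat \<Rightarrow> 'a) set" where
  "sft F = {s. (\<forall>n. s n \<in> alph F) \<and> (\<forall>n. transition F (s n) (s (Suc n)) = 1)}"

definition sft_on :: "'a multimap_data \<Rightarrow> 'a set \<Rightarrow> (nat \<Rightarrow> 'a) set" where
  "sft_on F C = {s \<in> sft F. \<forall>n. s n \<in> C}"

definition symbolic_space :: "'a multimap_data \<Rightarrow> (nat \<Rightarrow> 'a) set \<Rightarrow> (nat \<Rightarrow> 'a) topology" where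
  "symbolic_space F S = subtopology (product_topology (\<lambda>_. discrete_topology (alph F)) UNIV) S"

definition words_of_index :: "'a multimap_data \<Rightarrow> nat \<Rightarrow> 'a list set" where
  "words_of_index F n =
     {w. length w = Suc n \<and> set w \<subseteq> alph F \<and> (\<forall>i<n. transition F (w ! i) (w ! Suc i) = 1)}"

definition language :: "'a multimap_data \<Rightarrow> 'a list set" where
  "language F = (\<Union>n. words_of_index F n)"

definition language_on :: "'a multimap_data \<Rightarrow> 'a set \<Rightarrow> 'a list set" where
  "language_on F C = {w \<in> language F. set w \<subseteq> C}"

definition cylinder :: "'a multimap_data \<Rightarrow> 'a list \<Rightarrow> (nat \<Rightarrow> 'a) set" where
  "cylinder F u = {s \<in> sft F. map s [0..<length u] = u}"

definition transition_graph :: "'a multimap_data \<Rightarrow> ('a, 'a \<times> 'a) pre_digraph" where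
  "transition_graph F =
     \<lparr> verts = alph F, arcs = {(a, b). a \<in> alph F \<and> b \<in> alph F \<and> transition F a b = 1},
       tail = fst, head = snd \<rparr>"

definition irreducible_component :: "'a multimap_data \<Rightarrow> 'a set \<Rightarrow> bool" where
  "irreducible_component F C \<longleftrightarrow> C \<in> verts ` pre_digraph.sccs (transition_graph F)"

definition positive_entropy_component :: "'a multimap_data \<Rightarrow> 'a set \<Rightarrow> bool" where
  "positive_entropy_component F C \<longleftrightarrow>
     irreducible_component F C \<and> topological_entropy (symbolic_space F (sft_on F C)) left_shift > 0"


subsection \<open>Intervals\<close>

definition branch_inv :: "'a multimap_data \<Rightarrow> 'a \<Rightarrow> real \<Rightarrow> real" where
  "branch_inv F a y =
     (if a \<in> alph0 F then inv_into (Dset F a) (branch F a) y else the_elem (Dset F a))"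

definition word_interval :: "'a multimap_data \<Rightarrow> 'a list \<Rightarrow> real set" where
  "word_interval F w = foldr (\<lambda>a S. branch_inv F a ` S) (butlast w) (Dset F (last w))"

definition seq_interval :: "'a multimap_data \<Rightarrow> (nat \<Rightarrow> 'a) \<Rightarrow> real set" where
  "seq_interval F s = (\<Inter>n\<in>{1..}. word_interval F (map s [0..<Suc n]))"


subsection \<open>The class of multi-maps\<close>

definition coding_word :: "'a multimap_data \<Rightarrow> 'a set \<Rightarrow> 'a list \<Rightarrow> bool" where
  "coding_word F C u \<longleftrightarrow> u \<in> language_on F C \<and>
     (\<forall>s\<in>sft_on F C. infinite {n. (left_shift ^^ n) s \<in> cylinder F u} \<longrightarrow>
        is_singleton (seq_interval F s))"

definition avoiding_word :: "'a multimap_data \<Rightarrow> 'a set \<Rightarrow> 'a list \<Rightarrow> bool" where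
  "avoiding_word F C u \<longleftrightarrow> u \<in> language_on F C \<and>
     (\<forall>s\<in>cylinder F u. seq_interval F s \<inter> Pset F = {})"

definition class_F :: "'a multimap_data \<Rightarrow> bool" where
  "class_F F \<longleftrightarrow> markov_multimap F \<and> properly_parametrized F \<and>
     (\<forall>C. positive_entropy_component F C \<longrightarrow> (\<exists>u. coding_word F C u)) \<and>
     (\<forall>C. positive_entropy_component F C \<and> C \<subseteq> alph0 F \<longrightarrow> (\<exists>u. avoiding_word F C u)) \<and>
     topological_entropy (symbolic_space F (sft F)) left_shift > 0"

end

theory Submission
  imports Defs "HOL-Real_Asymp.Real_Asymp"
begin

text \<open>
  Both entropies equal the exponential growth rate \<open>g\<close> of the number of words of \<open>\<Sigma>\<^sub>M\<close>.

  Upper bound for \<open>X\<close>: since the sets \<open>G\<^sub>0 a\<close> partition the graph, every trajectory has an itinerary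
  in \<open>\<Sigma>\<^sub>M\<close>, and trajectories with the same itinerary of length \<open>n\<close> are linearly ordered in all
  coordinates at once, so that they need only linearly many \<open>\<epsilon>\<close>-classes.

  Lower bound for \<open>X\<close>: splitting words at the first and last visit to a letter shows that, for each
  \<open>\<gamma> < g\<close>, some letter \<open>a\<close> has more than \<open>K * exp (\<gamma> * n)\<close> loops of length \<open>n\<close>, for each \<open>K\<close> and a
  suitable \<open>n\<close>. The component of \<open>a\<close> then has positive entropy and contains a word \<open>v\<close> (an avoiding
  word, or a letter outside \<open>\<A>\<^sub>0\<close>) that forces \<open>x\<^sub>n\<close> into \<open>D\<^sub>0 (s\<^sub>n)\<close> whenever \<open>v\<close> occurs in \<open>s\<close> at \<open>n\<close>.
  A trajectory following a sequence in which \<open>v\<close> recurs with bounded gaps determines that sequence,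
  and freely concatenating the loops, each followed by a fixed loop through \<open>v\<close>, gives enough such
  sequences.
\<close>

section \<open>Bounds for topological entropy\<close>

text \<open>Neither space codes the other exactly. One sequence of \<open>\<Sigma>\<^sub>M\<close>
  may be followed by a whole interval of trajectories, so words alone do not resolve a cover of
  \<open>X\<close>. Conversely, a trajectory that meets a partition point may follow several
  sequences, because the closed pieces \<open>G(a)\<close> overlap at their ends, so distinct words
  need not give separated trajectories. The first defect costs a polynomial factor, which entropy
  does not see. The second disappears before any time at which the point lies in \<open>D0\<close>
  of its letter, so this must happen at arbitrarily late times. The factor \<open>K\<close> in the
  loop count pays for the detour through \<open>v\<close>: the detour has a fixed length
  \<open>c\<close>, and \<open>K = exp (\<gamma> * c)\<close> makes up for it.\<close>

lemma min_subcover_card_le: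
  assumes "finite \<W>" and "\<Union>\<W> = topspace T" and "\<And>W. W \<in> \<W> \<Longrightarrow> \<exists>U\<in>\<U>. W \<subseteq> U"
    and "\<And>U. U \<in> \<U> \<Longrightarrow> U \<subseteq> topspace T"
  shows "min_subcover_card T \<U> \<le> card \<W>"
proof -
  have "\<forall>W\<in>\<W>. \<exists>U. U \<in> \<U> \<and> W \<subseteq> U"
    using assms(3) by blast
  from bchoice[OF this] obtain h where h: "\<forall>W\<in>\<W>. h W \<in> \<U> \<and> W \<subseteq> h W" ..
  have "\<Union>(h ` \<W>) \<subseteq> topspace T"
    using h assms(4) by (intro UN_least) simp
  moreover have "\<Union>\<W> \<subseteq> \<Union>(h ` \<W>)"
    using h by fastforce
  ultimately have eq: "\<Union>(h ` \<W>) = topspace T"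
    using assms(2) by simp
  have "h ` \<W> \<subseteq> \<U>" using h by auto
  with eq assms(1) have "min_subcover_card T \<U> \<le> card (h ` \<W>)"
    unfolding min_subcover_card_def by (intro Least_le exI[of _ "h ` \<W>"]) simp
  also have "\<dots> \<le> card \<W>"
    using assms(1) by (rule card_image_le)
  finally show ?thesis .
qed

lemma card_le_min_subcover_card:
  assumes "finite \<U>" and "\<Union>\<U> = topspace T"
    and x: "\<And>w. w \<in> W \<Longrightarrow> x w \<in> topspace T"
    and sep: "\<And>U v w. U \<in> \<U> \<Longrightarrow> v \<in> W \<Longrightarrow> w \<in> W \<Longrightarrow> x v \<in> U \<Longrightarrow> x w \<in> U \<Longrightarrow> v = w"
  shows "card W \<le> min_subcover_card T \<U>"
proof -
  \<comment> \<open>The \<open>LEAST\<close> is attained only if a finite subcover exists;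
    \<open>\<U>\<close> itself is one.\<close>
  have "\<exists>\<V>. \<V> \<subseteq> \<U> \<and> finite \<V> \<and> card \<V> = min_subcover_card T \<U> \<and> \<Union>\<V> = topspace T"
    unfolding min_subcover_card_def by (rule LeastI_ex) (use assms(1,2) in blast)
  then obtain \<V> where \<V>: "\<V> \<subseteq> \<U>" "finite \<V>" "card \<V> = min_subcover_card T \<U>" "\<Union>\<V> = topspace T"
    by blast
  have "\<exists>V\<in>\<V>. x w \<in> V" if "w \<in> W" for w
    using x[OF that] \<V>(4) by blast
  then obtain h where h: "h w \<in> \<V>" "x w \<in> h w" if "w \<in> W" for w
    by metis
  have "inj_on h W"
  proof (rule inj_onI)
    fix v w assume vw: "v \<in> W" "w \<in> W" "h v = h w"
    then have "h v \<in> \<U>" using h(1) \<V>(1) by blast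
    then show "v = w" using sep[of "h v" v w] vw h(2)[OF vw(1)] h(2)[OF vw(2)] by simp
  qed
  then have "card W \<le> card \<V>"
    using h \<V>(2) by (intro card_inj_on_le[of h]) auto
  then show ?thesis using \<V>(3) by simp
qed

lemma iterated_cover_subset: "U \<in> iterated_cover T f \<U> n \<Longrightarrow> U \<subseteq> topspace T"
  by (auto simp: iterated_cover_def)

lemma finite_iterated_cover:
  assumes "finite \<U>"
  shows "finite (iterated_cover T f \<U> n)"
proof -
  have "iterated_cover T f \<U> n \<subseteq>
     (\<lambda>g. {x \<in> topspace T. \<forall>i<n. (f ^^ i) x \<in> g i}) ` ({..<n} \<rightarrow>\<^sub>E \<U>)"
  proof
    fix U assume "U \<in> iterated_cover T f \<U> n"
    then obtain g where g: "\<forall>i<n. g i \<in> \<U>" "U = {x \<in> topspace T. \<forall>i<n. (f ^^ i) x \<in> g i}"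
      by (auto simp: iterated_cover_def)
    show "U \<in> (\<lambda>g. {x \<in> topspace T. \<forall>i<n. (f ^^ i) x \<in> g i}) ` ({..<n} \<rightarrow>\<^sub>E \<U>)"
      by (rule image_eqI[of _ _ "restrict g {..<n}"]) (use g in auto)
  qed
  then show ?thesis
    by (rule finite_subset) (simp add: finite_PiE assms)
qed

lemma Union_iterated_cover:
  assumes "open_cover T \<U>" and "f ` topspace T \<subseteq> topspace T"
  shows "\<Union>(iterated_cover T f \<U> n) = topspace T"
proof -
  have "x \<in> \<Union>(iterated_cover T f \<U> n)" if x: "x \<in> topspace T" for x
  proof -
    have "(f ^^ i) x \<in> topspace T" for i
      using x assms(2) by (induction i) auto
    then have "\<exists>U\<in>\<U>. (f ^^ i) x \<in> U" for i
      using assms(1) by (auto simp: open_cover_def)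
    then obtain g where "g i \<in> \<U>" "(f ^^ i) x \<in> g i" for i
      by metis
    with x show ?thesis unfolding iterated_cover_def by blast
  qed
  then show ?thesis using iterated_cover_subset by blast
qed

text \<open>
  Distinct words get distinct members of the iterated cover, since \<open>(f ^^ i) x\<close> lies in only one of
  the sets \<open>V a\<close>.
\<close>

lemma card_words_le_min_subcover_card:
  assumes A: "finite A" and V: "open_cover T (V ` A)" and f: "f ` topspace T \<subseteq> topspace T"
    and W: "\<And>w. w \<in> W \<Longrightarrow> length w = n \<and> (\<exists>x\<in>topspace T. \<forall>i<n. \<forall>a\<in>A. (f ^^ i) x \<in> V a \<longleftrightarrow> a = w ! i)"
  shows "card W \<le> min_subcover_card T (iterated_cover T f (V ` A) n)"
proof -
  have "\<forall>w\<in>W. \<exists>x. x\<in>topspace T \<and> (\<forall>i<n. \<forall>a\<in>A. (f ^^ i) x \<in> V a \<longleftrightarrow> a = w ! i)"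
    using W by blast
  then obtain x where x: "\<And>w. w \<in> W \<Longrightarrow> x w \<in> topspace T"
    and xV: "\<And>w i a. w \<in> W \<Longrightarrow> i < n \<Longrightarrow> a \<in> A \<Longrightarrow> (f ^^ i) (x w) \<in> V a \<longleftrightarrow> a = w ! i"
    by metis
  show ?thesis
  proof (rule card_le_min_subcover_card[where x = x])
    show "finite (iterated_cover T f (V ` A) n)"
      using A by (intro finite_iterated_cover) simp
    show "\<Union>(iterated_cover T f (V ` A) n) = topspace T"
      using V f by (rule Union_iterated_cover)
    show "x w \<in> topspace T" if "w \<in> W" for w using x that .
    fix U v w
    assume U: "U \<in> iterated_cover T f (V ` A) n" and vw: "v \<in> W" "w \<in> W" "x v \<in> U" "x w \<in> U"
    then obtain g where g: "\<forall>i<n. g i \<in> V ` A" "U = {x \<in> topspace T. \<forall>i<n. (f ^^ i) x \<in> g i}"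
      by (auto simp: iterated_cover_def)
    have "v ! i = w ! i" if i: "i < n" for i
    proof -
      obtain a where "a \<in> A" "g i = V a" using g(1) i by blast
      then show ?thesis using xV[of v i a] xV[of w i a] g vw i by auto
    qed
    then show "v = w" using W vw by (intro nth_equalityI) auto
  qed
qed

section \<open>Exponential growth rates up to polynomial factors\<close>

lemma limsup_eq_of_null_sequence:
  fixes u v :: "nat \<Rightarrow> real"
  assumes "u \<longlonglongrightarrow> 0"
  shows "limsup (\<lambda>n. ereal (u n + v n)) = limsup (\<lambda>n. ereal (v n))"
proof -
  have "(\<lambda>n. ereal (u n)) \<longlonglongrightarrow> ereal 0" using assms by simp
  from ereal_limsup_lim_add[OF this, of "\<lambda>n. ereal (v n)"] show ?thesis by simp
qed

text \<open>After taking logarithms and dividing by \<open>n\<close>, a polynomial factor leaves a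
  null sequence. The hypothesis on \<open>N\<close> gives \<open>ln (N n) \<ge> 0\<close>, as
  \<open>ln 0 = 0\<close>, and this settles the case \<open>M n = 0\<close>. Real values of
  \<open>N\<close> admit powers of \<open>exp g\<close> besides cardinalities.\<close>

lemma log_growth_le:
  fixes M :: "nat \<Rightarrow> nat" and N :: "nat \<Rightarrow> real"
  assumes "c \<ge> 1" and N: "\<And>n. N n = 0 \<or> N n \<ge> 1" and le: "\<And>n. n > 0 \<Longrightarrow> real (M n) \<le> c * (real n + 1) ^ d * N n"
  shows "limsup (\<lambda>n. ereal (ln (real (M n)) / real n)) \<le> limsup (\<lambda>n. ereal (ln (N n) / real n))"
proof -
  have "(\<lambda>n. ln c * (1 / real n) + real d * (ln (real n + 1) / real n)) \<longlonglongrightarrow> ln c * 0 + real d * 0"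
    by (intro tendsto_intros) real_asymp+
  then have "(\<lambda>n. (ln c + real d * ln (real n + 1)) / real n) \<longlonglongrightarrow> 0"
    by (simp add: add_divide_distrib)
  from limsup_eq_of_null_sequence[OF this, of "\<lambda>n. ln (N n) / real n"]
  have eq: "limsup (\<lambda>n. ereal (ln (N n) / real n)) =
     limsup (\<lambda>n. ereal ((ln c + real d * ln (real n + 1)) / real n + ln (N n) / real n))" by simp
  have "ln (real (M n)) / real n \<le> (ln c + real d * ln (real n + 1)) / real n + ln (N n) / real n"
    if n: "n > 0" for n
  proof -
    have "ln (real (M n)) \<le> ln c + real d * ln (real n + 1) + ln (N n)"
    proof (cases "M n = 0")
      case True
      have "0 \<le> ln (N n)" using N[of n] by auto
      then show ?thesis using True assms(1) by simp
    next
      case False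
      then have "N n > 0" using le[OF n] N[of n] by auto
      have "ln (real (M n)) \<le> ln (c * (real n + 1) ^ d * N n)"
        using False le[OF n] by simp
      also have "\<dots> = ln c + real d * ln (real n + 1) + ln (N n)"
        using \<open>N n > 0\<close> assms(1) by (simp add: ln_mult ln_realpow)
      finally show ?thesis .
    qed
    then show ?thesis using n by (simp add: field_simps)
  qed
  then have "eventually (\<lambda>n. ereal (ln (real (M n)) / real n) \<le>
      ereal ((ln c + real d * ln (real n + 1)) / real n + ln (N n) / real n)) sequentially"
    by (intro eventually_sequentiallyI[of 1]) simp
  then show ?thesis unfolding eq by (rule Limsup_mono)
qed

text \<open>The constants may depend on the cover but \<open>N\<close> may not, so one bound serves
  for the supremum over all covers.\<close>

lemma topological_entropy_le:
  fixes N :: "nat \<Rightarrow> nat"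
  assumes "\<And>\<U>. open_cover T \<U> \<Longrightarrow> \<exists>c\<ge>1. \<exists>d. \<forall>n>0.
     real (min_subcover_card T (iterated_cover T f \<U> n)) \<le> c * (real n + 1) ^ d * real (N n)"
  shows "topological_entropy T f \<le> limsup (\<lambda>n. ereal (ln (real (N n)) / real n))"
  unfolding topological_entropy_def cover_entropy_def
proof (rule SUP_least)
  fix \<U> assume "\<U> \<in> {\<U>. open_cover T \<U>}"
  then obtain c d where "c \<ge> 1"
    "\<forall>n>0. real (min_subcover_card T (iterated_cover T f \<U> n)) \<le> c * (real n + 1) ^ d * real (N n)"
    using assms by blast
  then show "limsup (\<lambda>n. ereal (ln (real (min_subcover_card T (iterated_cover T f \<U> n))) / real n))
      \<le> limsup (\<lambda>n. ereal (ln (real (N n)) / real n))"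
    by (intro log_growth_le[where c = c and d = d]) auto
qed

lemma le_topological_entropy:
  assumes \<U>: "open_cover T \<U>" and N: "\<And>n. N n \<le> min_subcover_card T (iterated_cover T f \<U> n)"
  shows "limsup (\<lambda>n. ereal (ln (real (N n)) / real n)) \<le> topological_entropy T f"
proof -
  have "ln (real (N n)) / real n \<le> ln (real (min_subcover_card T (iterated_cover T f \<U> n))) / real n" for n
  proof (cases "N n = 0")
    case True
    have "0 \<le> ln (real (min_subcover_card T (iterated_cover T f \<U> n)))"
      by (cases "min_subcover_card T (iterated_cover T f \<U> n) = 0") auto
    with True show ?thesis by simp
  next
    case False
    then show ?thesis using N[of n] by (intro divide_right_mono) auto
  qed
  then have "limsup (\<lambda>n. ereal (ln (real (N n)) / real n)) \<le> cover_entropy T f \<U>"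
    unfolding cover_entropy_def by (intro Limsup_mono always_eventually) simp
  also have "\<dots> \<le> topological_entropy T f"
    unfolding topological_entropy_def using \<U> by (intro SUP_upper) simp
  finally show ?thesis .
qed

lemma ln_div_le_topological_entropy:
  assumes \<U>: "open_cover T \<U>" and m: "m > 0" and q: "q > 0"
    and le: "\<And>k. q ^ k \<le> min_subcover_card T (iterated_cover T f \<U> (k * m))"
  shows "ereal (ln (real q) / real m) \<le> topological_entropy T f"
proof -
  let ?u = "\<lambda>n. ereal (ln (real (min_subcover_card T (iterated_cover T f \<U> n))) / real n)"
  have "ereal (ln (real q) / real m) = limsup (\<lambda>k::nat. ereal (ln (real q) / real m))"
    by (simp add: Limsup_const)
  \<comment> \<open>A lower bound along the multiples of \<open>m\<close> suffices for a limit
    superior. The index \<open>Suc k\<close> skips time 0, where the quotient divides by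
    zero.\<close>
  also have "\<dots> \<le> limsup (?u \<circ> (\<lambda>k. Suc k * m))"
  proof (intro Limsup_mono always_eventually allI)
    fix k
    have "ln (real q) / real m = ln (real (q ^ Suc k)) / real (Suc k * m)"
      using q m by (simp add: ln_mult ln_realpow divide_simps del: power_Suc mult_Suc of_nat_Suc)
    also have "\<dots> \<le> ln (real (min_subcover_card T (iterated_cover T f \<U> (Suc k * m)))) / real (Suc k * m)"
    proof (intro divide_right_mono)
      have "0 < q ^ Suc k" using q by simp
      then show "ln (real (q ^ Suc k)) \<le> ln (real (min_subcover_card T (iterated_cover T f \<U> (Suc k * m))))"
        using le[of "Suc k"] by (metis ln_mono of_nat_0_less_iff of_nat_le_iff)
    qed simp
    finally show "ereal (ln (real q) / real m) \<le> (?u \<circ> (\<lambda>k. Suc k * m)) k" by simp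
  qed
  also have "\<dots> \<le> limsup ?u"
    using m by (intro limsup_subseq_mono strict_monoI) simp
  also have "\<dots> \<le> topological_entropy T f"
    unfolding topological_entropy_def cover_entropy_def using \<U> by (intro SUP_upper) simp
  finally show ?thesis .
qed

section \<open>Growth of factorial languages\<close>

text \<open>
  A word that uses the letter \<open>a\<close> splits, at the first and the last \<open>a\<close>, into a word from \<open>a\<close> to
  \<open>a\<close> between two words that avoid \<open>a\<close>.
\<close>

lemma card_words_insert_le:
  fixes L :: "'a list set" and a :: 'a
  defines "Q \<equiv> \<lambda>S n. {w \<in> L. length w = n \<and> set w \<subseteq> S}"
  defines "P \<equiv> \<lambda>n. {w \<in> L. length w = n \<and> w \<noteq> [] \<and> hd w = a \<and> last w = a}"
  assumes factorial: "\<And>u v w. u @ v @ w \<in> L \<Longrightarrow> v \<in> L"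
    and fin: "\<And>n. finite {w \<in> L. length w = n}"
  shows "card (Q (insert a S) n) \<le>
     card (Q S n) + (\<Sum>(i, j) \<in> {(i, j). i + j \<le> n}. card (Q S i) * (card (P j) * card (Q S (n - i - j))))"
proof -
  have finQ: "finite (Q S i)" for i
    unfolding Q_def by (rule finite_subset[OF _ fin[of i]]) auto
  have finP: "finite (P j)" for j
    unfolding P_def by (rule finite_subset[OF _ fin[of j]]) auto
  define I where "I = {(i, j). i + j \<le> n}"
  have finI: "finite I"
    unfolding I_def by (rule finite_subset[of _ "{..n} \<times> {..n}"]) auto
  define J where "J = (\<lambda>(i, j). (\<lambda>(u, l, v). u @ l @ v) ` (Q S i \<times> P j \<times> Q S (n - i - j)))"
  have "Q (insert a S) n \<subseteq> Q S n \<union> (\<Union>p\<in>I. J p)"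
  proof
    fix w assume w: "w \<in> Q (insert a S) n"
    show "w \<in> Q S n \<union> (\<Union>p\<in>I. J p)"
    proof (cases "a \<in> set w")
      case False
      with w show ?thesis by (auto simp: Q_def)
    next
      case True
      then obtain u z where u: "w = u @ a # z" "a \<notin> set u"
        using split_list_first by metis
      \<comment> \<open>Splitting \<open>a # z\<close> instead of \<open>z\<close> includes a single
        occurrence of \<open>a\<close>, where \<open>l = []\<close> and the middle word is
        \<open>[a]\<close>.\<close>
      have "a \<in> set (a # z)" by simp
      then obtain l v where v: "a # z = l @ a # v" "a \<notin> set v"
        using split_list_last by metis
      have hd: "hd (l @ [a]) = a" using v(1) by (cases l) auto
      have wuv: "w = u @ (l @ [a]) @ v" using u v by simp
      have "w \<in> L" "set w \<subseteq> insert a S" and n: "length w = n" using w by (auto simp: Q_def)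
      then have "u \<in> L" "l @ [a] \<in> L" "v \<in> L"
        using factorial[of "[]" u "(l @ [a]) @ v"] factorial[of u "l @ [a]" v]
          factorial[of "u @ l @ [a]" v "[]"] by (simp_all add: wuv)
      moreover have "set u \<subseteq> S" "set v \<subseteq> S"
        using \<open>set w \<subseteq> insert a S\<close> u v by (auto simp: wuv)
      ultimately have "u \<in> Q S (length u)" "l @ [a] \<in> P (length (l @ [a]))" "v \<in> Q S (length v)"
        using hd by (auto simp: Q_def P_def)
      moreover have "length v = n - length u - length (l @ [a])"
        using n by (simp add: wuv)
      ultimately have "w \<in> J (length u, length (l @ [a]))"
        unfolding J_def wuv by (auto intro!: image_eqI[where x = "(u, l @ [a], v)"])
      moreover have "(length u, length (l @ [a])) \<in> I"
        using n by (auto simp: I_def wuv)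
      ultimately show ?thesis by blast
    qed
  qed
  moreover have "finite (\<Union>p\<in>I. J p)"
    using finI finQ finP by (auto simp: J_def)
  ultimately have "card (Q (insert a S) n) \<le> card (Q S n \<union> (\<Union>p\<in>I. J p))"
    using finQ by (intro card_mono) auto
  also have "\<dots> \<le> card (Q S n) + card (\<Union>p\<in>I. J p)"
    by (rule card_Un_le)
  also have "card (\<Union>p\<in>I. J p) \<le> (\<Sum>p\<in>I. card (J p))"
    using finI by (rule card_UN_le)
  also have "\<dots> \<le> (\<Sum>(i, j)\<in>I. card (Q S i) * (card (P j) * card (Q S (n - i - j))))"
  proof (rule sum_mono)
    fix p assume "p \<in> I"
    obtain i j where p: "p = (i, j)" by (cases p)
    have "card (J (i, j)) \<le> card (Q S i \<times> P j \<times> Q S (n - i - j))"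
      unfolding J_def split by (intro card_image_le finite_cartesian_product finQ finP)
    then show "card (J p) \<le> (case p of (i, j) \<Rightarrow> card (Q S i) * (card (P j) * card (Q S (n - i - j))))"
      by (simp add: p card_cartesian_product)
  qed
  finally show ?thesis by (simp add: I_def)
qed

lemma card_words_le_of_loops:
  fixes L :: "'a list set" and r :: real
  assumes A: "finite A" "\<And>w. w \<in> L \<Longrightarrow> set w \<subseteq> A"
    and factorial: "\<And>u v w. u @ v @ w \<in> L \<Longrightarrow> v \<in> L"
    and r: "r \<ge> 1"
    and loops: "\<And>a. a \<in> A \<Longrightarrow>
      \<exists>K. \<forall>n. real (card {w \<in> L. length w = n \<and> w \<noteq> [] \<and> hd w = a \<and> last w = a}) \<le> K * r ^ n"
  shows "\<exists>c\<ge>1. \<exists>d. \<forall>n. real (card {w \<in> L. length w = n}) \<le> c * (real n + 1) ^ d * r ^ n"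
proof -
  have fin: "finite {w \<in> L. length w = n}" for n
    by (rule finite_subset[OF _ finite_lists_length_eq[OF A(1), of n]]) (use A(2) in auto)
  have "\<exists>c\<ge>1. \<exists>d. \<forall>n. real (card {w \<in> L. length w = n \<and> set w \<subseteq> S}) \<le> c * (real n + 1) ^ d * r ^ n"
    if "S \<subseteq> A" for S
    using finite_subset[OF that A(1)] that
  proof (induction S rule: finite_induct)
    case empty
    have "real (card {w \<in> L. length w = n \<and> set w \<subseteq> {}}) \<le> 1 * (real n + 1) ^ 0 * r ^ n" for n
    proof -
      have "card {w \<in> L. length w = n \<and> set w \<subseteq> {}} \<le> card {[] :: 'a list}"
        by (intro card_mono) auto
      also have "real \<dots> \<le> r ^ n" using r by simp
      finally show ?thesis by simp
    qed
    then show ?case by (intro exI[of _ 1] conjI exI[of _ "0 :: nat"]) auto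
  next
    case (insert a S)
    define Q where "Q = (\<lambda>S n. {w \<in> L. length w = n \<and> set w \<subseteq> S})"
    define P where "P = (\<lambda>n. {w \<in> L. length w = n \<and> w \<noteq> [] \<and> hd w = a \<and> last w = a})"
    obtain c d where c: "c \<ge> 1" and Q: "\<And>n. real (card (Q S n)) \<le> c * (real n + 1) ^ d * r ^ n"
      using insert.IH insert.prems by (auto simp: Q_def)
    obtain K where K: "\<And>n. real (card (P n)) \<le> K * r ^ n"
      using loops[of a] insert.prems by (auto simp: P_def)
    \<comment> \<open>No loop has length 0, so \<open>n = 0\<close> reads
      \<open>0 \<le> K\<close>.\<close>
    have "0 \<le> K" using K[of 0] by (simp add: P_def)
    have "real (card (Q (insert a S) n)) \<le> (c + c * c * K) * (real n + 1) ^ (2 + 2 * d) * r ^ n" for n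
    proof -
      define I where "I = {(i, j). i + j \<le> n}"
      have "I \<subseteq> {..n} \<times> {..n}" by (auto simp: I_def)
      then have "card I \<le> card ({..n} \<times> {..n})" by (intro card_mono) auto
      then have "real (card I) \<le> real (Suc n * Suc n)"
        by (simp only: of_nat_le_iff card_cartesian_product card_atMost)
      then have cardI: "real (card I) \<le> (real n + 1)\<^sup>2"
        by (simp add: power2_eq_square algebra_simps)
      have term_le: "real (card (Q S i) * (card (P j) * card (Q S (n - i - j)))) \<le>
          c * c * K * (real n + 1) ^ (2 * d) * r ^ n" if "(i, j) \<in> I" for i j
      proof -
        have ij: "i + j \<le> n" using that by (simp add: I_def)
        have poly: "real (card (Q S k)) \<le> c * (real n + 1) ^ d * r ^ k" if "k \<le> n" for k
        proof -
          have "c * (real k + 1) ^ d * r ^ k \<le> c * (real n + 1) ^ d * r ^ k"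
            using that c r by (intro mult_right_mono mult_left_mono power_mono) auto
          then show ?thesis using Q[of k] by linarith
        qed
        have "real (card (Q S i) * (card (P j) * card (Q S (n - i - j)))) \<le>
          (c * (real n + 1) ^ d * r ^ i) * ((K * r ^ j) * (c * (real n + 1) ^ d * r ^ (n - i - j)))"
          using ij poly[of i] poly[of "n - i - j"] K[of j] c r \<open>0 \<le> K\<close>
          by (simp only: of_nat_mult) (intro mult_mono; simp)
        also have "\<dots> = c * c * K * ((real n + 1) ^ d * (real n + 1) ^ d) * (r ^ i * r ^ j * r ^ (n - i - j))"
          by (simp only: mult_ac)
        also have "r ^ i * r ^ j * r ^ (n - i - j) = r ^ n"
          using ij by (simp flip: power_add)
        also have "(real n + 1) ^ d * (real n + 1) ^ d = (real n + 1) ^ (2 * d)"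
          by (simp add: mult_2 power_add)
        finally show ?thesis .
      qed
      have "card (Q (insert a S) n) \<le>
         card (Q S n) + (\<Sum>(i, j) \<in> I. card (Q S i) * (card (P j) * card (Q S (n - i - j))))"
        unfolding Q_def P_def I_def using factorial fin by (rule card_words_insert_le)
      then have "real (card (Q (insert a S) n)) \<le>
         real (card (Q S n)) + (\<Sum>(i, j) \<in> I. real (card (Q S i) * (card (P j) * card (Q S (n - i - j)))))"
        by (simp add: case_prod_unfold flip: of_nat_sum of_nat_add of_nat_mult)
      moreover have "(\<Sum>(i, j) \<in> I. real (card (Q S i) * (card (P j) * card (Q S (n - i - j))))) \<le>
         real (card I) * (c * c * K * (real n + 1) ^ (2 * d) * r ^ n)"
        by (rule sum_bounded_above) (use term_le in auto)
      moreover have "\<dots> \<le> (real n + 1)\<^sup>2 * (c * c * K * (real n + 1) ^ (2 * d) * r ^ n)"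
        using c r \<open>0 \<le> K\<close> by (intro mult_right_mono cardI) simp
      moreover have "\<dots> = c * c * K * (real n + 1) ^ (2 + 2 * d) * r ^ n"
        by (simp only: power_add mult_ac)
      moreover have "c * (real n + 1) ^ d * r ^ n \<le> c * (real n + 1) ^ (2 + 2 * d) * r ^ n"
        using c r by (intro mult_right_mono mult_left_mono power_increasing) auto
      moreover have "(c + c * c * K) * (real n + 1) ^ (2 + 2 * d) * r ^ n =
         c * (real n + 1) ^ (2 + 2 * d) * r ^ n + c * c * K * (real n + 1) ^ (2 + 2 * d) * r ^ n"
        by (simp only: distrib_right)
      ultimately show ?thesis using Q[of n] by linarith
    qed
    moreover have "c + c * c * K \<ge> 1" using c \<open>0 \<le> K\<close> by (simp add: add_increasing2)
    ultimately show ?case unfolding Q_def by blast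
  qed
  from this[of A] have "\<exists>c\<ge>1. \<exists>d. \<forall>n. real (card {w \<in> L. length w = n \<and> set w \<subseteq> A})
      \<le> c * (real n + 1) ^ d * r ^ n" by simp
  moreover have "{w \<in> L. length w = n \<and> set w \<subseteq> A} = {w \<in> L. length w = n}" for n
    using A(2) by auto
  ultimately show ?thesis by simp
qed


section \<open>Free concatenations\<close>

text \<open>With a common block length \<open>m\<close> the block boundaries are the multiples of
  \<open>m\<close>, so division with remainder describes the infinite concatenation.\<close>

definition conc :: "nat \<Rightarrow> (nat \<Rightarrow> 'a list) \<Rightarrow> nat \<Rightarrow> 'a" where
  "conc m \<beta> i = \<beta> (i div m) ! (i mod m)"

lemma conc_in_set:
  assumes "m > 0" and "length (\<beta> (i div m)) = m"
  shows "conc m \<beta> i \<in> set (\<beta> (i div m))"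
  using assms by (auto simp: conc_def)

lemma prefix_conc:
  assumes "\<And>i. length (\<beta> i) = m"
  shows "map (conc m \<beta>) [0..<k * m] = concat (map \<beta> [0..<k])"
proof (induction k)
  case (Suc k)
  have "[0..<Suc k * m] = [0..<k * m] @ [k * m..<k * m + m]"
    using upt_add_eq_append[of 0 "k * m" m] by (simp add: add.commute)
  moreover have "map (conc m \<beta>) [k * m..<k * m + m] = \<beta> k"
    using assms by (intro nth_equalityI) (auto simp: conc_def)
  ultimately show ?case using Suc by simp
qed simp

lemma conc_successive:
  assumes m: "m > 0" and len: "\<And>i. length (\<beta> i) = m"
    and inner: "\<And>i. successively E (\<beta> i)" and junction: "\<And>i. E (last (\<beta> i)) (hd (\<beta> (Suc i)))"
  shows "E (conc m \<beta> i) (conc m \<beta> (Suc i))"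
proof (cases "Suc (i mod m) = m")
  case True
  have "\<beta> j \<noteq> []" for j using len[of j] m by auto
  moreover have "m - Suc 0 = i mod m" using True by simp
  ultimately have "conc m \<beta> i = last (\<beta> (i div m))" "conc m \<beta> (Suc i) = hd (\<beta> (Suc (i div m)))"
    using True len by (auto simp: conc_def mod_Suc div_Suc last_conv_nth hd_conv_nth)
  then show ?thesis using junction by simp
next
  case False
  then have "Suc (i mod m) < m" using m by (metis Suc_lessI mod_less_divisor)
  with False show ?thesis
    using successively_nth[OF inner[of "i div m"], of "i mod m"] len m
    by (simp add: conc_def mod_Suc div_Suc)
qed

text \<open>Blocks of a common length can be read off from their concatenation, so different lists
  of \<open>k\<close> blocks give different words.\<close>

lemma card_concat_image:
  assumes "finite B" and "\<And>b. b \<in> B \<Longrightarrow> length b = m"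
  shows "card (concat ` {bs. set bs \<subseteq> B \<and> length bs = k}) = card B ^ k"
proof -
  have "inj_on concat {bs. set bs \<subseteq> B \<and> length bs = k}"
  proof (rule inj_onI)
    fix xs ys assume *: "xs \<in> {bs. set bs \<subseteq> B \<and> length bs = k}" "ys \<in> {bs. set bs \<subseteq> B \<and> length bs = k}"
      "concat xs = concat ys"
    have "length x = length y" if "(x, y) \<in> set (zip xs ys)" for x y
      using * assms(2) set_zip_leftD[OF that] set_zip_rightD[OF that] by (simp add: subset_iff)
    with * show "xs = ys" by (intro concat_injective) auto
  qed
  then show ?thesis using assms(1) by (simp add: card_image card_lists_length_eq)
qed

lemma successively_of_tranclp:
  assumes "E\<^sup>+\<^sup>+ a b"
  shows "\<exists>l. successively E (a # l @ [b])"
  using assms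
proof (induction rule: tranclp_induct)
  case (base y)
  then show ?case by (intro exI[of _ "[]"]) simp
next
  case (step y z)
  then obtain l where "successively E (a # l @ [y])" by blast
  with step.hyps(2) show ?case
    by (intro exI[of _ "l @ [y]"])
      (simp add: successively_append_iff successively_Cons hd_append split: if_splits)
qed

lemma rtranclp_of_successively:
  assumes "successively E w" and "i \<le> j" and "j < length w"
  shows "E\<^sup>*\<^sup>* (w ! i) (w ! j)"
  using assms(2,3)
proof (induction j rule: dec_induct)
  case (step n)
  then have "E (w ! n) (w ! Suc n)" using assms(1) successively_nth by metis
  with step show ?case by (auto intro: rtranclp.rtrancl_into_rtrancl)
qed simp

section \<open>Branches of a Markov multi-map\<close>

locale proper_markov_multimap =
  fixes F :: "'a multimap_data"
  assumes markov: "markov_multimap F" and proper: "properly_parametrized F"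
begin

lemma finite_alph: "finite (alph F)"
  using markov by (simp add: markov_multimap_def)

lemma pt_less: "i < j \<Longrightarrow> j \<le> npts F \<Longrightarrow> pt F i < pt F j"
  using markov by (auto simp: markov_multimap_def strict_mono_on_def)

lemma Pset_gap:
  assumes "x \<in> Pset F" and "i < npts F"
  shows "x \<le> pt F i \<or> pt F (Suc i) \<le> x"
proof -
  obtain j where j: "j \<le> npts F" "x = pt F j" using assms(1) by (auto simp: Pset_def)
  show ?thesis
  proof (cases "j \<le> i")
    case True
    then show ?thesis using pt_less[of j i] assms(2) j by (cases "j = i") auto
  next
    case False
    then show ?thesis using pt_less[of "Suc i" j] j by (cases "j = Suc i") auto
  qed
qed

lemma alph0E:
  assumes "a \<in> alph0 F"
  obtains i u v where "i < npts F" "Dset F a = {pt F i..pt F (Suc i)}" "u \<in> Pset F" "v \<in> Pset F"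
    "u < v" "Rset F a = {u..v}"
  using markov assms unfolding markov_multimap_def by blast

lemma not_alph0E:
  assumes "a \<in> alph F" "a \<notin> alph0 F"
  obtains p where "p \<in> Pset F" "Dset F a = {p}"
proof -
  have "\<exists>i\<le>npts F. Dset F a = {pt F i}"
    using markov assms unfolding markov_multimap_def alph_def by blast
  then show ?thesis using that by (force simp: Pset_def)
qed

lemma D0_cases:
  assumes "a \<in> alph F"
  obtains (open_interval) i where "a \<in> alph0 F" "i < npts F" "D0 F a = {pt F i<..<pt F (Suc i)}"
      "Dset F a = {pt F i..pt F (Suc i)}"
  | (point) p where "a \<notin> alph0 F" "p \<in> Pset F" "D0 F a = {p}" "Dset F a = {p}"
proof (cases "a \<in> alph0 F")
  case True
  then obtain i where "i < npts F" "Dset F a = {pt F i..pt F (Suc i)}" by (rule alph0E)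
  then show ?thesis using open_interval True by (simp add: D0_def)
next
  case False
  with assms show ?thesis by (elim not_alph0E) (use False point in \<open>auto simp: D0_def\<close>)
qed

lemma R0_cases:
  assumes "a \<in> alph F"
  obtains (open_interval) u v where "u \<in> Pset F" "v \<in> Pset F" "R0 F a = {u<..<v}" "Rset F a = {u..v}"
  | (point) u where "u \<in> Pset F" "R0 F a = {u}" "Rset F a = {u}"
proof (cases "a \<in> alph0 F \<union> alph1 F")
  case True
  then have "\<exists>u\<in>Pset F. \<exists>v\<in>Pset F. Rset F a = {u..v}"
    using markov unfolding markov_multimap_def by blast
  then show ?thesis using open_interval True by (auto simp: R0_def)
next
  case False
  then have "\<exists>u\<in>Pset F. Rset F a = {u}"
    using markov assms unfolding markov_multimap_def alph_def by blast
  then show ?thesis using point False by (auto simp: R0_def)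
qed

lemma D0_subset: "a \<in> alph F \<Longrightarrow> D0 F a \<subseteq> Dset F a"
  by (simp add: D0_def interior_subset)

lemma R0_subset: "a \<in> alph F \<Longrightarrow> R0 F a \<subseteq> Rset F a"
  by (simp add: R0_def interior_subset)

lemma D0_nonempty:
  assumes "a \<in> alph F"
  shows "D0 F a \<noteq> {}"
  using assms
proof (cases rule: D0_cases)
  case (open_interval i)
  then have "pt F i < pt F (Suc i)" by (intro pt_less) auto
  with open_interval show ?thesis by simp
qed simp

lemma Dset_bounds:
  assumes "a \<in> alph F"
  shows "Dset F a \<subseteq> {0..1}"
proof -
  have bounds: "0 \<le> pt F i \<and> pt F i \<le> 1" if "i \<le> npts F" for i
    using markov pt_less[of 0 i] pt_less[of i "npts F"] that
    by (cases "i = 0"; cases "i = npts F") (auto simp: markov_multimap_def)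
  from assms show ?thesis
  proof (cases rule: D0_cases)
    case (open_interval i)
    with bounds[of i] bounds[of "Suc i"] show ?thesis by auto
  next
    case (point p)
    with bounds show ?thesis by (auto simp: Pset_def)
  qed
qed

text \<open>
  \<open>R0 a\<close> is a union of partition points and gaps between neighbouring partition points, and \<open>D0 b\<close>
  is one of these.
\<close>

lemma D0_subset_R0:
  assumes "a \<in> alph F" "b \<in> alph F" "y \<in> R0 F a" "y \<in> D0 F b"
  shows "D0 F b \<subseteq> R0 F a"
  using assms(2)
proof (cases rule: D0_cases)
  case (open_interval i)
  from assms(1) show ?thesis
  proof (cases rule: R0_cases)
    case (open_interval u v)
    with \<open>i < npts F\<close> have "u \<le> pt F i \<or> pt F (Suc i) \<le> u" "v \<le> pt F i \<or> pt F (Suc i) \<le> v"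
      by (simp_all add: Pset_gap)
    then show ?thesis
      using assms(3,4) open_interval \<open>D0 F b = {pt F i<..<pt F (Suc i)}\<close> by auto
  next
    case (point u)
    with \<open>i < npts F\<close> have "u \<le> pt F i \<or> pt F (Suc i) \<le> u" by (simp add: Pset_gap)
    then show ?thesis
      using assms(3,4) point \<open>D0 F b = {pt F i<..<pt F (Suc i)}\<close> by auto
  qed
next
  case (point p)
  then show ?thesis using assms(3,4) by auto
qed

section \<open>Monotonicity and boundary behaviour of branches\<close>

lemma branch_inj: "a \<in> alph0 F \<Longrightarrow> inj_on (branch F a) (Dset F a)"
  and branch_image: "a \<in> alph0 F \<Longrightarrow> branch F a ` Dset F a = Rset F a"
  and branch_continuous: "a \<in> alph0 F \<Longrightarrow> continuous_on (Dset F a) (branch F a)"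
proof -
  assume "a \<in> alph0 F"
  then obtain g where g: "homeomorphism (Dset F a) (Rset F a) (branch F a) g"
    using markov unfolding markov_multimap_def by blast
  then show "inj_on (branch F a) (Dset F a)"
    by (intro inj_on_inverseI[of _ g]) (simp add: homeomorphism_def)
  from g show "branch F a ` Dset F a = Rset F a" "continuous_on (Dset F a) (branch F a)"
    by (simp_all add: homeomorphism_def)
qed

lemma branch_strict_mono:
  assumes "a \<in> alph0 F"
  shows "strict_mono_on (Dset F a) (branch F a) \<or> strict_antimono_on (Dset F a) (branch F a)"
proof -
  obtain i where "Dset F a = {pt F i..pt F (Suc i)}" using assms by (rule alph0E)
  then have "is_interval (Dset F a)" by (simp add: is_interval_cc)
  then show ?thesis
    using injective_eq_monotone_map[OF _ branch_continuous[OF assms]] branch_inj[OF assms] by simp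
qed

text \<open>A monotone surjection between compact intervals attains its extreme values at the
  endpoints; stating the result for unordered pairs hides the orientation.\<close>

lemma branch_endpoints:
  assumes a: "a \<in> alph0 F" and D: "Dset F a = {p..q}" "p < q" and R: "Rset F a = {u..v}"
  shows "{branch F a p, branch F a q} = {u, v}"
proof -
  have pq: "p \<in> Dset F a" "q \<in> Dset F a" using D by auto
  have "u \<in> Rset F a" "v \<in> Rset F a" using R branch_image[OF a] pq by auto
  then have "u \<in> branch F a ` {p..q}" "v \<in> branch F a ` {p..q}"
    using R branch_image[OF a] D(1) by auto
  then obtain x y where x: "x \<in> {p..q}" "branch F a x = u" and y: "y \<in> {p..q}" "branch F a y = v"
    by auto
  have bounds: "branch F a p \<in> {u..v}" "branch F a q \<in> {u..v}"
    using pq branch_image[OF a] R by blast+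
  consider "strict_mono_on {p..q} (branch F a)" | "strict_antimono_on {p..q} (branch F a)"
    using branch_strict_mono[OF a] D by auto
  then show ?thesis
  proof cases
    case 1
    then have "branch F a p \<le> u" "v \<le> branch F a q"
      using x y by (auto dest!: strict_mono_on_imp_mono_on simp: mono_on_def)
    then show ?thesis using bounds by auto
  next
    case 2
    have "branch F a q \<le> u" "v \<le> branch F a p"
      using monotone_onD[OF 2, of x q] monotone_onD[OF 2, of p y] x y D(2)
      by (cases "x = q"; cases "y = p"; auto)+
    then show ?thesis using bounds by auto
  qed
qed

text \<open>The branch is injective and maps endpoints to endpoints, and \<open>D0\<close> and
  \<open>R0\<close> arise by deleting exactly these points.\<close>

lemma branch_interior:
  assumes a: "a \<in> alph0 F" and x: "x \<in> Dset F a"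
  shows "branch F a x \<in> R0 F a \<longleftrightarrow> x \<in> D0 F a"
proof -
  obtain i u v where i: "i < npts F" and D: "Dset F a = {pt F i..pt F (Suc i)}"
    and R: "Rset F a = {u..v}"
    using a by (rule alph0E)
  have less: "pt F i < pt F (Suc i)" using i by (intro pt_less) auto
  have "branch F a x \<in> {branch F a (pt F i), branch F a (pt F (Suc i))} \<longleftrightarrow> x \<in> {pt F i, pt F (Suc i)}"
    using inj_on_eq_iff[OF branch_inj[OF a] x, of "pt F i"] less
      inj_on_eq_iff[OF branch_inj[OF a] x, of "pt F (Suc i)"] by (simp add: D)
  moreover have "branch F a x \<in> Rset F a" using branch_image[OF a] x by blast
  moreover have "R0 F a = Rset F a - {branch F a (pt F i), branch F a (pt F (Suc i))}"
    unfolding branch_endpoints[OF a D less R] using a by (auto simp: R R0_def)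
  moreover have "D0 F a = Dset F a - {pt F i, pt F (Suc i)}"
    using a by (auto simp: D D0_def)
  ultimately show ?thesis using x by blast
qed

lemma graph_subset: "a \<in> alph F \<Longrightarrow> (x, y) \<in> graph_of F a \<Longrightarrow> x \<in> Dset F a \<and> y \<in> Rset F a"
  using branch_image[of a] by (auto simp: graph_of_def split: if_splits)

text \<open>Only the target coordinate has to be tested. For a branch this is
  \<open>branch_interior\<close>; for the other letters \<open>D0\<close> and \<open>Dset\<close>
  agree. This asymmetry is what lets membership in \<open>D0\<close> travel backwards in
  time.\<close>

lemma graph0_iff:
  assumes "a \<in> alph F"
  shows "(x, y) \<in> graph0_of F a \<longleftrightarrow> (x, y) \<in> graph_of F a \<and> y \<in> R0 F a"
  using assms D0_subset[OF assms] R0_subset[OF assms] branch_interior[of a]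
  by (auto simp: graph0_of_def graph_of_def D0_def)

lemma graph0_subset:
  assumes "a \<in> alph F" "(x, y) \<in> graph0_of F a"
  shows "x \<in> D0 F a \<and> y \<in> R0 F a"
  using assms graph0_iff[OF assms(1), of x y] by (auto simp: graph0_of_def split: if_splits)

lemma graph0_disjoint:
  "a \<in> alph F \<Longrightarrow> b \<in> alph F \<Longrightarrow> z \<in> graph0_of F a \<Longrightarrow> z \<in> graph0_of F b \<Longrightarrow> a = b"
  using proper unfolding properly_parametrized_def by blast

lemma closed_graph:
  assumes "a \<in> alph F"
  shows "closed (graph_of F a)"
proof (cases "a \<in> alph0 F")
  case True
  have "compact (Dset F a)" using True by (elim alph0E) simp
  then have "compact ((\<lambda>x. (x, branch F a x)) ` Dset F a)"
    using branch_continuous[OF True] by (intro compact_continuous_image continuous_intros)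
  moreover have "graph_of F a = (\<lambda>x. (x, branch F a x)) ` Dset F a"
    using True by (auto simp: graph_of_def)
  ultimately show ?thesis by (simp add: compact_imp_closed)
next
  case False
  have "closed (Dset F a)" using assms by (cases rule: D0_cases) auto
  moreover have "closed (Rset F a)" using assms by (cases rule: R0_cases) auto
  ultimately show ?thesis using False by (simp add: graph_of_def closed_Times)
qed

text \<open>Vertical segments leave the target undetermined, but never the source: branches are
  injective and all other letters have a one-point domain.\<close>

lemma graph_determines_source:
  assumes "a \<in> alph F" "(x, y) \<in> graph_of F a" "(x', y) \<in> graph_of F a"
  shows "x = x'"
proof (cases "a \<in> alph0 F")
  case True
  with assms show ?thesis by (auto simp: graph_of_def dest: inj_onD[OF branch_inj])
next
  case False
  with assms(1) obtain p where "Dset F a = {p}" by (rule not_alph0E)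
  with False assms show ?thesis by (auto simp: graph_of_def)
qed

lemma sftI:
  assumes "\<And>n. s n \<in> alph F" "\<And>n. D0 F (s (Suc n)) \<subseteq> R0 F (s n)"
  shows "s \<in> sft F"
  using assms by (simp add: sft_def transition_def)

lemma sftD:
  assumes "s \<in> sft F"
  shows "s n \<in> alph F" "D0 F (s (Suc n)) \<subseteq> R0 F (s n)"
  using assms by (auto simp: sft_def transition_def split: if_splits)


section \<open>Itineraries\<close>

text \<open>With the closed pieces \<open>graph_of\<close> in place of \<open>graph0_of\<close> the
  relation is closed, so that compactness provides a follower for every point of the SFT. The price
  is that a trajectory may follow several sequences.\<close>

definition follows :: "(nat \<Rightarrow> 'a) \<Rightarrow> (nat \<Rightarrow> real) \<Rightarrow> bool" where
  "follows s x \<longleftrightarrow> (\<forall>n. (x n, x (Suc n)) \<in> graph_of F (s n))"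

lemma itinerary_exists:
  assumes "x \<in> trajectories F"
  shows "\<exists>s\<in>sft F. follows s x"
proof -
  have "(x n, x (Suc n)) \<in> (\<Union>a\<in>alph F. graph0_of F a)" for n
    using assms proper by (simp add: trajectories_def multimap_image_def properly_parametrized_def)
  then have "\<exists>a. a \<in> alph F \<and> (x n, x (Suc n)) \<in> graph0_of F a" for n by blast
  then obtain s where s: "s n \<in> alph F" "(x n, x (Suc n)) \<in> graph0_of F (s n)" for n by metis
  \<comment> \<open>The point \<open>x (Suc n)\<close> lies both in \<open>R0\<close> of the present
    letter and in \<open>D0\<close> of the next one; by the Markov property one common point is
    enough.\<close>
  have "D0 F (s (Suc n)) \<subseteq> R0 F (s n)" for n
    using s graph0_subset[OF s(1) s(2), of n] graph0_subset[OF s(1) s(2), of "Suc n"]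
    by (intro D0_subset_R0) auto
  then have "s \<in> sft F" using s by (intro sftI)
  moreover have "follows s x" using s graph0_iff by (auto simp: follows_def)
  ultimately show ?thesis by blast
qed

lemma follows_trajectory:
  assumes "s \<in> sft F" "follows s x"
  shows "x \<in> trajectories F"
proof -
  have "x n \<in> {0..1}" for n
    using graph_subset[OF sftD(1)[OF assms(1)]] assms(2) Dset_bounds[OF sftD(1)[OF assms(1)]]
    unfolding follows_def by blast
  moreover have "x (Suc n) \<in> multimap_image F (x n)" for n
    using sftD(1)[OF assms(1), of n] assms(2)
    by (auto simp: follows_def multimap_image_def multimap_graph_def)
  ultimately show ?thesis by (simp add: trajectories_def)
qed

lemma left_shift_funpow: "(left_shift ^^ n) s = (\<lambda>i. s (n + i))"
  by (induction n arbitrary: s) (auto simp: left_shift_def funpow_swap1)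

lemma follows_shift: "follows s x \<Longrightarrow> follows (\<lambda>i. s (n + i)) (\<lambda>i. x (n + i))"
  by (auto simp: follows_def)

text \<open>The condition \<open>x n \<in> D0 (s n)\<close> propagates backwards along a trajectory that follows \<open>s\<close>.\<close>

lemma follows_graph0:
  assumes s: "s \<in> sft F" and x: "follows s x" and "x n \<in> D0 F (s n)" and "m < n"
  shows "(x m, x (Suc m)) \<in> graph0_of F (s m)"
proof -
  have step: "(x k, x (Suc k)) \<in> graph0_of F (s k)" if "x (Suc k) \<in> D0 F (s (Suc k))" for k
    using that x graph0_iff[OF sftD(1)[OF s]] sftD(2)[OF s, of k] by (auto simp: follows_def)
  have "x m \<in> D0 F (s m)" if "m \<le> n" for m
    using that assms(3)
  proof (induction m rule: inc_induct)
    case (step k)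
    then show ?case using \<open>\<And>k. x (Suc k) \<in> D0 F (s (Suc k)) \<Longrightarrow> _ k\<close> graph0_subset[OF sftD(1)[OF s]] by blast
  qed
  with \<open>m < n\<close> show ?thesis by (intro step) simp
qed

text \<open>Before their anchoring times both sequences use the pieces \<open>graph0_of\<close>,
  which are disjoint. The two anchoring times may differ.\<close>

lemma follows_same_itinerary:
  assumes s: "s \<in> sft F" "follows s x" "x n \<in> D0 F (s n)" "m < n"
    and t: "t \<in> sft F" "follows t x" "x n' \<in> D0 F (t n')" "m < n'"
  shows "s m = t m"
  using graph0_disjoint[OF sftD(1)[OF s(1)] sftD(1)[OF t(1)] follows_graph0[OF s] follows_graph0[OF t]] .

section \<open>The entropy of the trajectory space is at most the word growth\<close>


definition prefixes :: "nat \<Rightarrow> 'a list set" where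
  "prefixes n = (\<lambda>s. map s [0..<n]) ` sft F"

lemma prefixes_subset_lists:
  assumes "w \<in> prefixes n"
  shows "length w = n" and "set w \<subseteq> alph F"
  using assms sftD(1) by (auto simp: prefixes_def)

lemma finite_prefixes: "finite (prefixes n)"
  by (rule finite_subset[OF _ finite_lists_length_eq[OF finite_alph, of n]])
    (use prefixes_subset_lists in blast)

lemma sft_shift: "s \<in> sft F \<Longrightarrow> (\<lambda>i. s (n + i)) \<in> sft F"
  by (rule sftI) (simp_all add: sftD)

lemma map_shift: "map (\<lambda>i. s (n + i)) [0..<k] = map s [n..<n + k]"
  by (rule nth_equalityI) auto

lemma map_in_prefixes:
  assumes "s \<in> sft F"
  shows "map s [n..<n + k] \<in> prefixes k"
  unfolding prefixes_def using sft_shift[OF assms, of n] map_shift[of s n k] by (metis imageI)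

text \<open>Cutting a word after \<open>n\<close> letters loses nothing. This trades the count at
  \<open>n + k\<close> for the count at \<open>n\<close> at the cost of a constant factor.\<close>

lemma card_prefixes_add_le: "card (prefixes (n + k)) \<le> card (prefixes n) * card (prefixes k)"
proof -
  have "card (prefixes (n + k)) \<le> card (prefixes n \<times> prefixes k)"
  proof (rule card_inj_on_le[where f = "\<lambda>w. (take n w, drop n w)"])
    show "inj_on (\<lambda>w. (take n w, drop n w)) (prefixes (n + k))"
      by (rule inj_onI) (metis append_take_drop_id prod.inject)
    show "(\<lambda>w. (take n w, drop n w)) ` prefixes (n + k) \<subseteq> prefixes n \<times> prefixes k"
    proof (intro image_subsetI)
      fix w assume "w \<in> prefixes (n + k)"
      then obtain s where s: "s \<in> sft F" "w = map s [0..<n + k]" by (auto simp: prefixes_def)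
      have "take n w = map s [0..<0 + n]" "drop n w = map s [n..<n + k]"
        by (simp_all add: s take_map drop_map)
      then show "(take n w, drop n w) \<in> prefixes n \<times> prefixes k"
        using map_in_prefixes[OF s(1), of 0 n] map_in_prefixes[OF s(1), of n k] by simp
    qed
  qed (simp add: finite_prefixes)
  then show ?thesis by (simp add: card_cartesian_product)
qed

definition word_growth :: ereal where
  "word_growth = limsup (\<lambda>n. ereal (ln (real (card (prefixes n))) / real n))"

text \<open>The common form of both upper bounds: a window of \<open>k\<close> coordinates resolves
  the cover, so a word of length \<open>n + k\<close> is needed, and each word splits into at most
  \<open>(n + k) * q + 1\<close> classes. For the SFT \<open>q = 0\<close>; for trajectories
  \<open>q\<close> is the fineness of a grid.\<close>

lemma topological_entropy_le_word_growth:
  assumes "\<And>\<U>. open_cover T \<U> \<Longrightarrow>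
    \<exists>k q. \<forall>n. min_subcover_card T (iterated_cover T f \<U> n) \<le> card (prefixes (n + k)) * ((n + k) * q + 1)"
  shows "topological_entropy T f \<le> word_growth"
  unfolding word_growth_def
proof (rule topological_entropy_le)
  fix \<U> assume "open_cover T \<U>"
  then obtain k q where
    kq: "\<And>n. min_subcover_card T (iterated_cover T f \<U> n) \<le> card (prefixes (n + k)) * ((n + k) * q + 1)"
    using assms by blast
  \<comment> \<open>The last factor comes from
    \<open>(n + k) * q + 1 \<le> (k * q + q + 1) * (n + 1)\<close>; the summand 1 ensures
    \<open>c \<ge> 1\<close> even if there are no words.\<close>
  define c where "c = 1 + card (prefixes k) * (k * q + q + 1)"
  have "min_subcover_card T (iterated_cover T f \<U> n) \<le> c * (n + 1) ^ 1 * card (prefixes n)" for n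
  proof -
    have "min_subcover_card T (iterated_cover T f \<U> n) \<le>
        (card (prefixes n) * card (prefixes k)) * ((n + k) * q + 1)"
      using kq[of n] card_prefixes_add_le[of n k] by (meson le_trans mult_le_mono1)
    also have "\<dots> \<le> (card (prefixes n) * card (prefixes k)) * ((k * q + q + 1) * (n + 1))"
      by (intro mult_le_mono2) (simp add: algebra_simps)
    also have "\<dots> = (card (prefixes k) * (k * q + q + 1)) * (n + 1) ^ 1 * card (prefixes n)"
      by (simp only: mult_ac power_one_right)
    also have "\<dots> \<le> c * (n + 1) ^ 1 * card (prefixes n)"
      unfolding c_def by (intro mult_le_mono1) simp
    finally show ?thesis .
  qed
  then have "real (min_subcover_card T (iterated_cover T f \<U> n)) \<le> real (c * (n + 1) ^ 1 * card (prefixes n))" for n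
    by (simp only: of_nat_le_iff)
  then have "real (min_subcover_card T (iterated_cover T f \<U> n)) \<le>
      real c * (real n + 1) ^ 1 * real (card (prefixes n))" for n
    by (simp only: of_nat_mult of_nat_power of_nat_add of_nat_1)
  moreover have "1 \<le> real c" by (simp add: c_def)
  ultimately show "\<exists>c\<ge>1. \<exists>d. \<forall>n>0. real (min_subcover_card T (iterated_cover T f \<U> n)) \<le>
      c * (real n + 1) ^ d * real (card (prefixes n))"
    by blast
qed

text \<open>
  With orientations chosen along the word, trajectories that follow the same word are linearly
  ordered in all coordinates simultaneously: a letter outside \<open>alph0\<close> determines all earlier
  coordinates, and a letter in \<open>alph0\<close> carries the order on by a monotone branch.
\<close>

lemma same_word_linearly_ordered:
  assumes "set w \<subseteq> alph F"
  shows "\<exists>\<sigma> :: nat \<Rightarrow> bool. \<forall>x y.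
     (\<forall>i<length w. (x i, x (Suc i)) \<in> graph_of F (w ! i) \<and> (y i, y (Suc i)) \<in> graph_of F (w ! i)) \<longrightarrow>
     (\<forall>i\<le>length w. if \<sigma> i then x i \<le> y i else y i \<le> x i) \<or>
     (\<forall>i\<le>length w. if \<sigma> i then y i \<le> x i else x i \<le> y i)"
proof -
  \<comment> \<open>The orientation flips exactly at the decreasing branches.\<close>
  define \<sigma> where "\<sigma> = rec_nat True (\<lambda>i b. if w ! i \<in> alph0 F \<and>
     strict_antimono_on (Dset F (w ! i)) (branch F (w ! i)) then \<not> b else b)"
  have \<sigma>_Suc: "\<sigma> (Suc i) = (if w ! i \<in> alph0 F \<and>
     strict_antimono_on (Dset F (w ! i)) (branch F (w ! i)) then \<not> \<sigma> i else \<sigma> i)" for i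
    by (simp add: \<sigma>_def)
  have "(\<forall>i\<le>N. if \<sigma> i then x i \<le> y i else y i \<le> x i) \<or> (\<forall>i\<le>N. if \<sigma> i then y i \<le> x i else x i \<le> y i)"
    if "N \<le> length w"
      and graph: "\<forall>i<length w. (x i, x (Suc i)) \<in> graph_of F (w ! i) \<and> (y i, y (Suc i)) \<in> graph_of F (w ! i)" for N x y
    using that(1)
  proof (induction N)
    case 0
    then show ?case by auto
  next
    case (Suc N)
    define a where "a = w ! N"
    have a: "a \<in> alph F" and xy: "(x N, x (Suc N)) \<in> graph_of F a" "(y N, y (Suc N)) \<in> graph_of F a"
      using Suc.prems graph assms by (auto simp: a_def)
    show ?case
    proof (cases "a \<in> alph0 F")
      case True
      have xyN: "x N \<in> Dset F a" "x (Suc N) = branch F a (x N)" "y N \<in> Dset F a" "y (Suc N) = branch F a (y N)"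
        using xy True by (auto simp: graph_of_def)
      have anti: "u \<le> v \<Longrightarrow> branch F a v \<le> branch F a u"
        if "strict_antimono_on (Dset F a) (branch F a)" "u \<in> Dset F a" "v \<in> Dset F a" for u v
        using monotone_onD[OF that] by (cases "u = v") auto
      have mono: "u \<le> v \<Longrightarrow> branch F a u \<le> branch F a v"
        if "\<not> strict_antimono_on (Dset F a) (branch F a)" "u \<in> Dset F a" "v \<in> Dset F a" for u v
        using branch_strict_mono[OF True] that
        by (auto dest!: strict_mono_on_imp_mono_on simp: mono_on_def)
      define P where "P = (\<lambda>i. if \<sigma> i then x i \<le> y i else y i \<le> x i)"
      define Q where "Q = (\<lambda>i. if \<sigma> i then y i \<le> x i else x i \<le> y i)"
      have "P (Suc N)" if "P N"
        unfolding P_def using that xyN True anti mono by (simp add: P_def Q_def \<sigma>_Suc flip: a_def split: if_splits)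
      moreover have "Q (Suc N)" if "Q N"
        unfolding Q_def using that xyN True anti mono by (simp add: P_def Q_def \<sigma>_Suc flip: a_def split: if_splits)
      moreover have "(\<forall>i\<le>N. P i) \<or> (\<forall>i\<le>N. Q i)"
        using Suc.IH Suc.prems unfolding P_def Q_def by simp
      ultimately have "(\<forall>i\<le>Suc N. P i) \<or> (\<forall>i\<le>Suc N. Q i)"
        by (auto simp: le_Suc_eq)
      then show ?thesis unfolding P_def Q_def .
    next
      case False
      with a obtain p where "Dset F a = {p}" by (rule not_alph0E)
      then have "x N = y N" using graph_subset[OF a xy(1)] graph_subset[OF a xy(2)] by simp
      have "x i = y i" if "i \<le> N" for i
        using that
      proof (induction i rule: inc_induct)
        case base
        show ?case by fact
      next
        case (step i)
        have i: "i < length w" using step.hyps Suc.prems by simp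
        show ?case
        proof (rule graph_determines_source)
          show "w ! i \<in> alph F" using i assms by (meson nth_mem subsetD)
          show "(x i, x (Suc i)) \<in> graph_of F (w ! i)" "(y i, x (Suc i)) \<in> graph_of F (w ! i)"
            using i graph step.IH by auto
        qed
      qed
      \<comment> \<open>Up to \<open>N\<close> the trajectories coincide, so both orders hold there
        and the comparison at \<open>Suc N\<close> selects one.\<close>
      then show ?thesis by (cases "x (Suc N) \<le> y (Suc N)") (auto simp: le_Suc_eq)
    qed
  qed
  then show ?thesis by blast
qed

text \<open>
  The sum of the discretized coordinates, each reversed according to its orientation, is monotone
  along this order, so its value determines every discretized coordinate.
\<close>

lemma same_word_grid:
  assumes w: "set w \<subseteq> alph F" and q: "q > 0"
  shows "\<exists>\<Phi> :: (nat \<Rightarrow> real) \<Rightarrow> nat. \<forall>x y.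
     (\<forall>i. x i \<in> {0..1} \<and> y i \<in> {0..1}) \<longrightarrow>
     (\<forall>i<length w. (x i, x (Suc i)) \<in> graph_of F (w ! i) \<and> (y i, y (Suc i)) \<in> graph_of F (w ! i)) \<longrightarrow>
     \<Phi> x \<le> length w * q \<and> (\<Phi> x = \<Phi> y \<longrightarrow> (\<forall>i<length w. \<bar>x i - y i\<bar> \<le> 1 / real q))"
proof -
  obtain \<sigma> :: "nat \<Rightarrow> bool" where \<sigma>: "\<And>x y.
     (\<forall>i<length w. (x i, x (Suc i)) \<in> graph_of F (w ! i) \<and> (y i, y (Suc i)) \<in> graph_of F (w ! i)) \<Longrightarrow>
     (\<forall>i\<le>length w. if \<sigma> i then x i \<le> y i else y i \<le> x i) \<or>
     (\<forall>i\<le>length w. if \<sigma> i then y i \<le> x i else x i \<le> y i)"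
    using same_word_linearly_ordered[OF w] by blast
  \<comment> \<open>Reversal by \<open>1 - x i\<close> stays in the unit interval, so each summand
    is at most \<open>q\<close>.\<close>
  define z where "z = (\<lambda>(x :: nat \<Rightarrow> real) i. nat \<lfloor>real q * (if \<sigma> i then x i else 1 - x i)\<rfloor>)"
  define \<Phi> where "\<Phi> = (\<lambda>x. \<Sum>i<length w. z x i)"
  have close: "\<bar>x i - y i\<bar> \<le> 1 / real q" if "x i \<in> {0..1}" "y i \<in> {0..1}" "z x i = z y i" for x y i
  proof -
    define u v where "u = (if \<sigma> i then x i else 1 - x i)" and "v = (if \<sigma> i then y i else 1 - y i)"
    have "0 \<le> u" "0 \<le> v" using that by (auto simp: u_def v_def)
    then have "0 \<le> \<lfloor>real q * u\<rfloor>" "0 \<le> \<lfloor>real q * v\<rfloor>" by simp_all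
    then have "\<lfloor>real q * u\<rfloor> = \<lfloor>real q * v\<rfloor>"
      using that(3) unfolding z_def u_def[symmetric] v_def[symmetric] by linarith
    then have "\<bar>real q * u - real q * v\<bar> < 1" by linarith
    then have "real q * \<bar>u - v\<bar> < 1" by (simp add: abs_mult flip: right_diff_distrib)
    moreover have "\<bar>u - v\<bar> = \<bar>x i - y i\<bar>" by (auto simp: u_def v_def)
    ultimately show ?thesis using q by (simp add: field_simps)
  qed
  have z_mono: "z x i \<le> z y i" if "if \<sigma> i then x i \<le> y i else y i \<le> x i" for x y i
    unfolding z_def using that by (intro nat_mono floor_mono mult_left_mono) (auto split: if_splits)
  have z_le: "z x i \<le> q" if "x i \<in> {0..1}" for x i
  proof -
    have "real q * (if \<sigma> i then x i else 1 - x i) \<le> real q * 1"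
      using that by (intro mult_left_mono) auto
    then show ?thesis unfolding z_def by linarith
  qed
  have "\<Phi> x \<le> length w * q" if "\<forall>i. x i \<in> {0..1}" for x
  proof -
    have "\<Phi> x \<le> (\<Sum>i<length w. q)" unfolding \<Phi>_def using that z_le by (intro sum_mono) auto
    then show ?thesis by simp
  qed
  moreover have "z x i = z y i"
    if graph: "\<forall>i<length w. (x i, x (Suc i)) \<in> graph_of F (w ! i) \<and> (y i, y (Suc i)) \<in> graph_of F (w ! i)"
      and eq: "\<Phi> x = \<Phi> y" and i: "i < length w" for x y i
    using \<sigma>[OF graph]
  proof
    assume "\<forall>i\<le>length w. if \<sigma> i then x i \<le> y i else y i \<le> x i"
    then have "z x i \<le> z y i" if "i < length w" for i using that by (intro z_mono) auto
    then show ?thesis using i eq[unfolded \<Phi>_def] by (intro sum_mono_inv[of "z x" "{..<length w}" "z y"]) auto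
  next
    assume "\<forall>i\<le>length w. if \<sigma> i then y i \<le> x i else x i \<le> y i"
    then have "z y i \<le> z x i" if "i < length w" for i using that by (intro z_mono) auto
    then show ?thesis
      using i eq[unfolded \<Phi>_def, symmetric] by (intro sum_mono_inv[of "z y" "{..<length w}" "z x", symmetric]) auto
  qed
  ultimately show ?thesis using close by (intro exI[of _ \<Phi>] allI impI conjI) auto
qed

text \<open>As a subspace of the euclidean function space, \<open>X\<close> carries a metric, which
  makes a Lebesgue number available.\<close>

lemma trajectory_space_eq: "trajectory_space F = top_of_set (trajectories F)"
proof -
  have "product_topology (\<lambda>_::nat. top_of_set {0..1::real}) UNIV =
      top_of_set (UNIV \<rightarrow>\<^sub>E {0..1})"
    by (simp add: euclidean_product_topology flip: subtopology_product_topology)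
  then show ?thesis
    by (simp add: trajectory_space_def subtopology_subtopology)
      (auto simp: trajectories_def intro!: arg_cong[where f = "subtopology euclidean"])
qed

lemma closed_follow_step:
  assumes "a \<in> alph F"
  shows "closed {x :: nat \<Rightarrow> real. (x n, x (Suc n)) \<in> graph_of F a}"
proof -
  have "continuous_on UNIV (\<lambda>x :: nat \<Rightarrow> real. (x n, x (Suc n)))"
    by (intro continuous_on_Pair continuous_on_product_coordinates)
  from closed_vimage[OF closed_graph[OF assms] this] show ?thesis by (simp add: vimage_def)
qed

lemma compact_unit_sequences: "compact {x :: nat \<Rightarrow> real. \<forall>n. x n \<in> {0..1}}"
proof -
  have "compactin (product_topology (\<lambda>_::nat. euclidean) UNIV) (UNIV \<rightarrow>\<^sub>E {0..1::real})"
    by (simp add: compactin_PiE)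
  moreover have "(UNIV \<rightarrow>\<^sub>E {0..1::real}) = {x :: nat \<Rightarrow> real. \<forall>n. x n \<in> {0..1}}" by auto
  ultimately show ?thesis by (simp add: euclidean_product_topology)
qed

lemma compact_trajectories: "compact (trajectories F)"
proof -
  have "trajectories F = {x. \<forall>n. x n \<in> {0..1}} \<inter>
      (\<Inter>n. \<Union>a\<in>alph F. {x. (x n, x (Suc n)) \<in> graph_of F a})"
    by (auto simp: trajectories_def multimap_image_def multimap_graph_def)
  then show ?thesis
    by (simp only:)
      (intro compact_Int_closed compact_unit_sequences closed_INT closed_UN closed_follow_step ballI finite_alph)
qed

lemma left_shift_trajectories: "left_shift ` trajectories F \<subseteq> trajectories F"
  by (auto simp: trajectories_def left_shift_def)

text \<open>The metric on sequences weights the coordinates along the enumeration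
  \<open>from_nat\<close>: what lies beyond index \<open>N\<close> contributes at most
  \<open>(1/2) ^ N\<close>, and the rest at most twice its maximum.\<close>

lemma dist_sequences_less:
  assumes "e > 0"
  shows "\<exists>k q. q > 0 \<and> (\<forall>x y :: nat \<Rightarrow> real. (\<forall>i<k. \<bar>x i - y i\<bar> \<le> 1 / real q) \<longrightarrow> dist x y < e)"
proof -
  obtain N where N: "(1/2) ^ N < e / 2" using assms by (metis half_gt_zero one_less_numeral_iff real_arch_pow_inv
      semiring_norm(76) divide_less_eq_1_pos zero_less_numeral half_gt_zero_iff)
  obtain q :: nat where q: "4 / e < real q" using reals_Archimedean2 by blast
  then have "q > 0" using assms by (cases q) (auto simp: field_simps)
  \<comment> \<open>\<open>k\<close> exceeds every coordinate that is enumerated up to index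
    \<open>N\<close>.\<close>
  define k where "k = Suc (Max (from_nat ` {..N}) :: nat)"
  have "dist x y < e" if "\<forall>i<k. \<bar>x i - y i\<bar> \<le> 1 / real q" for x y :: "nat \<Rightarrow> real"
  proof -
    have "dist (x (from_nat n)) (y (from_nat n)) \<le> 1 / real q" if "n \<le> N" for n
    proof -
      have "(from_nat n :: nat) \<le> Max (from_nat ` {..N})" using that by (intro Max_ge) auto
      then show ?thesis using \<open>\<forall>i<k. _ i\<close> by (simp add: k_def dist_real_def)
    qed
    then have "Max {dist (x (from_nat n)) (y (from_nat n)) |n. n \<le> N} \<le> 1 / real q"
      by (subst Max_le_iff) auto
    then have "dist x y \<le> 2 * (1 / real q) + (1/2) ^ N"
      using dist_fun_le_dist_first_terms[of x y N] by linarith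
    moreover have "2 * (1 / real q) < e / 2" using q assms \<open>q > 0\<close> by (simp add: field_simps)
    ultimately show ?thesis using N by linarith
  qed
  with \<open>q > 0\<close> show ?thesis by blast
qed

text \<open>A Lebesgue number \<open>e\<close> reduces the cover to closeness up to
  \<open>1 / q\<close> on \<open>k\<close> coordinates. At the times below \<open>n\<close> this
  concerns coordinates below \<open>n + k\<close>, all controlled by a word of that length and its
  grid value.\<close>

lemma trajectory_cover_bound:
  assumes \<U>: "open_cover (trajectory_space F) \<U>"
  shows "\<exists>k q. \<forall>n. min_subcover_card (trajectory_space F) (iterated_cover (trajectory_space F) left_shift \<U> n)
     \<le> card (prefixes (n + k)) * ((n + k) * q + 1)"
proof -
  define X where "X = trajectories F"
  have T: "trajectory_space F = top_of_set X" by (simp add: X_def trajectory_space_eq)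
  have "X \<subseteq> \<Union>{G. open G \<and> X \<inter> G \<in> \<U>}"
  proof
    fix x assume "x \<in> X"
    then obtain U where "U \<in> \<U>" "x \<in> U" using \<U> by (auto simp: open_cover_def T)
    moreover have "openin (top_of_set X) U" using \<U> \<open>U \<in> \<U>\<close> by (simp add: open_cover_def T)
    ultimately show "x \<in> \<Union>{G. open G \<and> X \<inter> G \<in> \<U>}" by (auto simp: openin_open)
  qed
  then obtain e where e: "e > 0" "\<And>x. x \<in> X \<Longrightarrow> \<exists>G\<in>{G. open G \<and> X \<inter> G \<in> \<U>}. ball x e \<subseteq> G"
    using Heine_Borel_lemma[of X "{G. open G \<and> X \<inter> G \<in> \<U>}"] compact_trajectories unfolding X_def by blast
  obtain k q where q: "q > 0"
    and kq: "\<And>x y :: nat \<Rightarrow> real. \<forall>i<k. \<bar>x i - y i\<bar> \<le> 1 / real q \<Longrightarrow> dist x y < e"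
    using dist_sequences_less[OF e(1)] by blast
  have near: "\<exists>U\<in>\<U>. \<forall>y\<in>X. (\<forall>i<k. \<bar>x i - y i\<bar> \<le> 1 / real q) \<longrightarrow> y \<in> U" if x: "x \<in> X" for x
  proof -
    obtain G where "X \<inter> G \<in> \<U>" "ball x e \<subseteq> G" using e(2)[OF x] by blast
    then show ?thesis using kq by (intro bexI[of _ "X \<inter> G"]) (auto simp: subset_iff)
  qed
  have "\<exists>s. s \<in> sft F \<and> follows s x" if "x \<in> X" for x
    using itinerary_exists that by (auto simp: X_def)
  \<comment> \<open>A trajectory may follow several sequences; one is fixed for each.\<close>
  then obtain itin where itin: "\<And>x. x \<in> X \<Longrightarrow> itin x \<in> sft F" "\<And>x. x \<in> X \<Longrightarrow> follows (itin x) x"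
    by metis
  have unit: "x i \<in> {0..1}" if "x \<in> X" for x i using that unfolding X_def trajectories_def by blast
  have "min_subcover_card (top_of_set X) (iterated_cover (top_of_set X) left_shift \<U> n)
     \<le> card (prefixes (n + k)) * ((n + k) * q + 1)" for n
  proof -
    define N where "N = n + k"
    have "\<forall>w\<in>prefixes N. \<exists>\<Phi> :: (nat \<Rightarrow> real) \<Rightarrow> nat. \<forall>x y.
     (\<forall>i. x i \<in> {0..1} \<and> y i \<in> {0..1}) \<longrightarrow>
     (\<forall>i<length w. (x i, x (Suc i)) \<in> graph_of F (w ! i) \<and> (y i, y (Suc i)) \<in> graph_of F (w ! i)) \<longrightarrow>
     \<Phi> x \<le> length w * q \<and> (\<Phi> x = \<Phi> y \<longrightarrow> (\<forall>i<length w. \<bar>x i - y i\<bar> \<le> 1 / real q))"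
      using same_word_grid[OF prefixes_subset_lists(2) q] by (intro ballI)
    from bchoice[OF this] obtain \<Phi> :: "'a list \<Rightarrow> (nat \<Rightarrow> real) \<Rightarrow> nat" where
      \<Phi>: "\<And>w x y. w \<in> prefixes N \<Longrightarrow> \<forall>i. x i \<in> {0..1} \<and> y i \<in> {0..1} \<Longrightarrow>
       \<forall>i<length w. (x i, x (Suc i)) \<in> graph_of F (w ! i) \<and> (y i, y (Suc i)) \<in> graph_of F (w ! i) \<Longrightarrow>
       \<Phi> w x \<le> length w * q \<and> (\<Phi> w x = \<Phi> w y \<longrightarrow> (\<forall>i<length w. \<bar>x i - y i\<bar> \<le> 1 / real q))"
      by blast
    define word where "word = (\<lambda>x. map (itin x) [0..<N])"
    define code where "code = (\<lambda>x. (word x, \<Phi> (word x) x))"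
    have word: "word x \<in> prefixes N" if "x \<in> X" for x
      using itin(1)[OF that] by (auto simp: word_def prefixes_def)
    have len: "length (word x) = N" for x by (simp add: word_def)
    have graph: "\<forall>i<N. (x i, x (Suc i)) \<in> graph_of F (word x ! i)" if "x \<in> X" for x
      using itin(2)[OF that] by (simp add: follows_def word_def)
    have close: "\<bar>x i - y i\<bar> \<le> 1 / real q" if "x \<in> X" "y \<in> X" "code x = code y" "i < N" for x y i
    proof -
      have "word y = word x" "\<Phi> (word x) x = \<Phi> (word x) y"
        using that(3) unfolding code_def by (metis prod.inject)+
      then show ?thesis
        using \<Phi>[OF word[OF that(1)], of x y] graph[OF that(1)] graph[OF that(2)] that unit
        by (simp add: len)
    qed
    \<comment> \<open>The classes of equal code need not be open; they only have to refine the
      iterated cover.\<close>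
    define \<W> where "\<W> = (\<lambda>c. {y \<in> X. code y = c}) ` (code ` X)"
    have code_sub: "code ` X \<subseteq> prefixes N \<times> {..N * q}"
    proof (intro image_subsetI)
      fix x assume x: "x \<in> X"
      show "code x \<in> prefixes N \<times> {..N * q}"
        using \<Phi>[OF word[OF x], of x x] graph[OF x] unit[OF x] word[OF x] by (simp add: code_def len)
    qed
    then have fin: "finite (code ` X)" by (rule finite_subset) (simp add: finite_prefixes)
    have "min_subcover_card (top_of_set X) (iterated_cover (top_of_set X) left_shift \<U> n) \<le> card \<W>"
    proof (rule min_subcover_card_le)
      show "finite \<W>" using fin by (simp add: \<W>_def)
      show "\<Union>\<W> = topspace (top_of_set X)" by (auto simp: \<W>_def)
      show "U \<subseteq> topspace (top_of_set X)" if "U \<in> iterated_cover (top_of_set X) left_shift \<U> n" for U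
        using that by (rule iterated_cover_subset)
      fix W assume "W \<in> \<W>"
      then obtain x where x: "x \<in> X" "W = {y \<in> X. code y = code x}" by (auto simp: \<W>_def)
      have shift: "(left_shift ^^ i) y \<in> X" if "y \<in> X" for y i
        using that left_shift_trajectories by (induction i) (auto simp: X_def)
      have "\<forall>i. \<exists>U. U \<in> \<U> \<and> (\<forall>y\<in>X. (\<forall>j<k. \<bar>(left_shift ^^ i) x j - y j\<bar> \<le> 1 / real q) \<longrightarrow> y \<in> U)"
        using near[OF shift[OF x(1)]] by blast
      from choice[OF this] obtain g where g: "\<And>i. g i \<in> \<U>"
        and gX: "\<And>i y. y \<in> X \<Longrightarrow> \<forall>j<k. \<bar>(left_shift ^^ i) x j - y j\<bar> \<le> 1 / real q \<Longrightarrow> y \<in> g i"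
        by blast
      have "(left_shift ^^ i) y \<in> g i" if "y \<in> W" "i < n" for y i
      proof (rule gX)
        show "(left_shift ^^ i) y \<in> X" using that x shift by simp
        show "\<forall>j<k. \<bar>(left_shift ^^ i) x j - (left_shift ^^ i) y j\<bar> \<le> 1 / real q"
          using that x close[of x y] by (simp add: left_shift_funpow N_def)
      qed
      then have "W \<subseteq> {y \<in> topspace (top_of_set X). \<forall>i<n. (left_shift ^^ i) y \<in> g i}"
        using x by auto
      moreover have "{y \<in> topspace (top_of_set X). \<forall>i<n. (left_shift ^^ i) y \<in> g i} \<in>
          iterated_cover (top_of_set X) left_shift \<U> n"
        unfolding iterated_cover_def using g by blast
      ultimately show "\<exists>U\<in>iterated_cover (top_of_set X) left_shift \<U> n. W \<subseteq> U" by blast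
    qed
    also have "\<dots> \<le> card (code ` X)" unfolding \<W>_def using fin by (rule card_image_le)
    also have "\<dots> \<le> card (prefixes N \<times> {..N * q})"
      using code_sub by (intro card_mono) (simp_all add: finite_prefixes)
    finally show ?thesis by (simp add: card_cartesian_product N_def)
  qed
  then show ?thesis unfolding T by blast
qed

section \<open>Symbolic spaces\<close>


definition full_shift :: "(nat \<Rightarrow> 'a) topology" where
  "full_shift = product_topology (\<lambda>_. discrete_topology (alph F)) UNIV"

lemma topspace_full_shift: "topspace full_shift = {s. \<forall>n. s n \<in> alph F}"
  by (auto simp: full_shift_def)

lemma compact_full_shift: "compact_space full_shift"
  using finite_alph by (simp add: full_shift_def compact_space_product_topology compact_space_discrete_topology)

text \<open>Fixing the first \<open>k\<close> letters is a basic open condition of the product.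
  Negation preserves dependence on \<open>k\<close> letters, so such sets are clopen.\<close>

lemma openin_full_shift_local:
  assumes "\<And>s t. \<forall>i<k. s i = t i \<Longrightarrow> \<phi> s = \<phi> t"
  shows "openin full_shift {s \<in> topspace full_shift. \<phi> s}"
  unfolding full_shift_def openin_product_topology_alt
proof
  fix s assume s: "s \<in> {s \<in> topspace (product_topology (\<lambda>_. discrete_topology (alph F)) UNIV). \<phi> s}"
  define U where "U = (\<lambda>i. if i < k then {s i} else alph F)"
  have "finite {i \<in> UNIV. U i \<noteq> topspace (discrete_topology (alph F))}"
    by (rule finite_subset[of _ "{..<k}"]) (auto simp: U_def split: if_splits)
  moreover have "\<forall>i\<in>UNIV. openin (discrete_topology (alph F)) (U i)"
    using s by (auto simp: U_def PiE_iff)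
  moreover have "s \<in> Pi\<^sub>E UNIV U"
    using s by (auto simp: U_def PiE_iff)
  moreover have "Pi\<^sub>E UNIV U \<subseteq> {s \<in> topspace (product_topology (\<lambda>_. discrete_topology (alph F)) UNIV). \<phi> s}"
  proof
    fix t assume t: "t \<in> Pi\<^sub>E UNIV U"
    then have ti: "t i \<in> U i" for i by (simp add: PiE_iff)
    have "t i \<in> alph F" for i using ti[of i] s by (auto simp: U_def PiE_iff split: if_splits)
    moreover have "s i = t i" if "i < k" for i using ti[of i] that by (simp add: U_def)
    then have "\<phi> t" using assms[of s t] s by simp
    ultimately show "t \<in> {s \<in> topspace (product_topology (\<lambda>_. discrete_topology (alph F)) UNIV). \<phi> s}"
      by (simp add: PiE_iff)
  qed
  ultimately show "\<exists>U. finite {i \<in> UNIV. U i \<noteq> topspace (discrete_topology (alph F))} \<and>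
      (\<forall>i\<in>UNIV. openin (discrete_topology (alph F)) (U i)) \<and> s \<in> Pi\<^sub>E UNIV U \<and>
      Pi\<^sub>E UNIV U \<subseteq> {s \<in> topspace (product_topology (\<lambda>_. discrete_topology (alph F)) UNIV). \<phi> s}"
    by blast
qed

lemma closedin_full_shift_local:
  assumes "\<And>s t. \<forall>i<k. s i = t i \<Longrightarrow> \<phi> s = \<phi> t"
  shows "closedin full_shift {s \<in> topspace full_shift. \<phi> s}"
proof -
  have "openin full_shift {s \<in> topspace full_shift. \<not> \<phi> s}"
    using assms by (intro openin_full_shift_local[where k = k]) blast
  moreover have "topspace full_shift - {s \<in> topspace full_shift. \<phi> s} = {s \<in> topspace full_shift. \<not> \<phi> s}"
    by blast
  ultimately show ?thesis by (simp add: closedin_def)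
qed

lemma closedin_full_shift_all_local:
  assumes "\<And>n :: nat. \<exists>k. \<forall>s t. (\<forall>i<k. s i = t i) \<longrightarrow> \<phi> n s = \<phi> n t"
  shows "closedin full_shift {s \<in> topspace full_shift. \<forall>n. \<phi> n s}"
proof -
  have "closedin full_shift {s \<in> topspace full_shift. \<phi> n s}" for n
    using assms[of n] closedin_full_shift_local by blast
  then have "closedin full_shift (\<Inter>n. {s \<in> topspace full_shift. \<phi> n s})"
    by (intro closedin_Inter) auto
  moreover have "(\<Inter>n. {s \<in> topspace full_shift. \<phi> n s}) = {s \<in> topspace full_shift. \<forall>n. \<phi> n s}"
    by auto
  ultimately show ?thesis by simp
qed

lemma symbolic_space_eq: "symbolic_space F S = subtopology full_shift S"
  by (simp add: symbolic_space_def full_shift_def)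

lemma sft_subset_full_shift: "sft F \<subseteq> topspace full_shift"
  by (auto simp: topspace_full_shift sftD)

lemma topspace_symbolic_space: "S \<subseteq> sft F \<Longrightarrow> topspace (symbolic_space F S) = S"
  using sft_subset_full_shift by (auto simp: symbolic_space_eq)

lemma openin_cylinder:
  assumes "S \<subseteq> sft F" and "\<And>s t. \<forall>i<k. s i = t i \<Longrightarrow> \<phi> s = \<phi> t"
  shows "openin (symbolic_space F S) {s \<in> S. \<phi> s}"
proof -
  have "{s \<in> S. \<phi> s} = {s \<in> topspace full_shift. \<phi> s} \<inter> S"
    using assms(1) sft_subset_full_shift by auto
  then show ?thesis
    using openin_full_shift_local[of k \<phi>] assms(2) by (auto simp: symbolic_space_eq openin_subtopology)
qed

lemma closedin_sft: "closedin full_shift (sft F)"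
proof -
  have "sft F = {s \<in> topspace full_shift. \<forall>n. transition F (s n) (s (Suc n)) = 1}"
    by (auto simp: sft_def topspace_full_shift)
  moreover have "\<exists>k. \<forall>s t. (\<forall>i<k. s i = t i) \<longrightarrow>
      (transition F (s n) (s (Suc n)) = 1) = (transition F (t n) (t (Suc n)) = 1)" for n
    by (rule exI[of _ "Suc (Suc n)"]) auto
  then have "closedin full_shift {s \<in> topspace full_shift. \<forall>n. transition F (s n) (s (Suc n)) = 1}"
    by (rule closedin_full_shift_all_local)
  ultimately show ?thesis by simp
qed

text \<open>The Lebesgue number argument for cylinders: by compactness finitely many cylinders
  inside members of the cover suffice, and \<open>k\<close> is their greatest length.\<close>

lemma symbolic_cover_fine:
  assumes \<U>: "open_cover (symbolic_space F (sft F)) \<U>"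
  shows "\<exists>k. \<forall>s\<in>sft F. \<exists>U\<in>\<U>. \<forall>t\<in>sft F. (\<forall>i<k. s i = t i) \<longrightarrow> t \<in> U"
proof -
  define cyl where "cyl = (\<lambda>k s. {t \<in> sft F. \<forall>i<k. s i = (t i :: 'a)})"
  define \<C> where "\<C> = {cyl k s | k s. \<exists>U\<in>\<U>. cyl k s \<subseteq> U}"
  have T: "topspace (symbolic_space F (sft F)) = sft F" by (simp add: topspace_symbolic_space)
  have "compact_space (symbolic_space F (sft F))"
    unfolding symbolic_space_eq by (intro compact_space_subtopology closedin_compact_space compact_full_shift closedin_sft)
  moreover have "\<forall>C\<in>\<C>. openin (symbolic_space F (sft F)) C"
  proof
    fix C assume "C \<in> \<C>"
    then obtain k s where "C = cyl k s" by (auto simp: \<C>_def)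
    then show "openin (symbolic_space F (sft F)) C"
      unfolding cyl_def by (simp only:) (rule openin_cylinder[where k = k], auto)
  qed
  moreover have "sft F \<subseteq> \<Union>\<C>"
  proof
    fix s assume s: "s \<in> sft F"
    then obtain U where U: "U \<in> \<U>" "s \<in> U" using \<U> by (auto simp: open_cover_def T)
    then have "openin (symbolic_space F (sft F)) U" using \<U> by (simp add: open_cover_def)
    then obtain V where V: "openin full_shift V" "U = V \<inter> sft F"
      by (auto simp: symbolic_space_eq openin_subtopology)
    then obtain W where fin: "finite {i. W i \<noteq> alph F}" and W: "s \<in> Pi\<^sub>E UNIV W" "Pi\<^sub>E UNIV W \<subseteq> V"
      using U(2) by (auto simp: full_shift_def openin_product_topology_alt)
    from finite_nat_set_iff_bounded[THEN iffD1, OF fin] obtain k where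
      k: "\<And>i. W i \<noteq> alph F \<Longrightarrow> i < k" by auto
    have "cyl k s \<subseteq> U"
    proof
      fix t assume t: "t \<in> cyl k s"
      have "t i \<in> W i" for i
      proof (cases "i < k")
        case True
        then have "t i = s i" using t by (simp add: cyl_def)
        then show ?thesis using W(1) by (simp add: PiE_iff)
      next
        case False
        then show ?thesis using k[of i] t sftD(1)[of t i] by (auto simp: cyl_def)
      qed
      then have "t \<in> Pi\<^sub>E UNIV W" by (simp add: PiE_iff)
      then show "t \<in> U" using V(2) W(2) t by (auto simp: cyl_def)
    qed
    then have "cyl k s \<in> \<C>" using U(1) by (auto simp: \<C>_def)
    moreover have "s \<in> cyl k s" using s by (simp add: cyl_def)
    ultimately show "s \<in> \<Union>\<C>" by blast
  qed
  ultimately obtain \<F> where \<F>: "finite \<F>" "\<F> \<subseteq> \<C>" "sft F \<subseteq> \<Union>\<F>"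
    unfolding compact_space_def compactin_def T by blast
  have "\<forall>C\<in>\<F>. \<exists>k. \<exists>s. C = cyl k s \<and> (\<exists>U\<in>\<U>. cyl k s \<subseteq> U)" using \<F>(2) unfolding \<C>_def by blast
  from bchoice[OF this] obtain \<kappa> where \<kappa>: "\<And>C. C \<in> \<F> \<Longrightarrow> \<exists>s. C = cyl (\<kappa> C) s \<and> (\<exists>U\<in>\<U>. cyl (\<kappa> C) s \<subseteq> U)"
    by blast
  \<comment> \<open>The inserted 0 keeps \<open>Max\<close> meaningful for an empty family.\<close>
  define k where "k = Max (insert 0 (\<kappa> ` \<F>))"
  have "\<exists>U\<in>\<U>. \<forall>t\<in>sft F. (\<forall>i<k. s i = t i) \<longrightarrow> t \<in> U" if s: "s \<in> sft F" for s
  proof -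
    obtain C where C: "C \<in> \<F>" "s \<in> C" using \<F>(3) s by blast
    obtain s' U where U: "C = cyl (\<kappa> C) s'" "U \<in> \<U>" "C \<subseteq> U" using \<kappa>[OF C(1)] by metis
    have "\<kappa> C \<le> k" unfolding k_def using C(1) \<F>(1) by (intro Max_ge) auto
    have "t \<in> C" if "t \<in> sft F" "\<forall>i<k. s i = t i" for t
    proof -
      have "\<forall>i<\<kappa> C. s' i = s i" using C(2) U(1) unfolding cyl_def by blast
      then have "t \<in> cyl (\<kappa> C) s'" using that \<open>\<kappa> C \<le> k\<close> by (simp add: cyl_def)
      then show ?thesis using U(1) by simp
    qed
    then show ?thesis using U by blast
  qed
  then show ?thesis by blast
qed

lemma symbolic_entropy_le_word_growth:
  "topological_entropy (symbolic_space F (sft F)) left_shift \<le> word_growth"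
proof (rule topological_entropy_le_word_growth)
  fix \<U> assume "open_cover (symbolic_space F (sft F)) \<U>"
  from symbolic_cover_fine[OF this] obtain k where
    k: "\<And>s. s \<in> sft F \<Longrightarrow> \<exists>U\<in>\<U>. \<forall>t\<in>sft F. (\<forall>i<k. s i = t i) \<longrightarrow> t \<in> U" by blast
  let ?T = "symbolic_space F (sft F)"
  have T: "topspace ?T = sft F" by (simp add: topspace_symbolic_space)
  have "min_subcover_card ?T (iterated_cover ?T left_shift \<U> n) \<le> card (prefixes (n + k)) * ((n + k) * 0 + 1)" for n
  proof -
    define \<W> where "\<W> = (\<lambda>w. {s \<in> sft F. map s [0..<n + k] = w}) ` prefixes (n + k)"
    have "min_subcover_card ?T (iterated_cover ?T left_shift \<U> n) \<le> card \<W>"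
    proof (rule min_subcover_card_le)
      show "finite \<W>" by (simp add: \<W>_def finite_prefixes)
      show "\<Union>\<W> = topspace ?T" by (auto simp: \<W>_def T prefixes_def)
      show "U \<subseteq> topspace ?T" if "U \<in> iterated_cover ?T left_shift \<U> n" for U
        using that by (rule iterated_cover_subset)
      fix W assume "W \<in> \<W>"
      then obtain s where s: "s \<in> sft F" "W = {t \<in> sft F. map t [0..<n + k] = map s [0..<n + k]}"
        by (auto simp: \<W>_def prefixes_def)
      have "\<forall>i. \<exists>U. U \<in> \<U> \<and> (\<forall>t\<in>sft F. (\<forall>j<k. s (i + j) = t j) \<longrightarrow> t \<in> U)"
        using k[OF sft_shift[OF s(1)]] by blast
      from choice[OF this] obtain g where g: "\<And>i. g i \<in> \<U>"
        and gU: "\<And>i t. t \<in> sft F \<Longrightarrow> \<forall>j<k. s (i + j) = t j \<Longrightarrow> t \<in> g i" by blast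
      have "(left_shift ^^ i) t \<in> g i" if t: "t \<in> W" and i: "i < n" for t i
      proof -
        have "t \<in> sft F" and eq: "map t [0..<n + k] = map s [0..<n + k]" using t s(2) by auto
        have "t j = s j" if "j < n + k" for j using arg_cong[OF eq, of "\<lambda>l. l ! j"] that by simp
        then show ?thesis using i \<open>t \<in> sft F\<close>
          unfolding left_shift_funpow by (intro gU sft_shift) auto
      qed
      then have "W \<subseteq> {t \<in> topspace ?T. \<forall>i<n. (left_shift ^^ i) t \<in> g i}"
        using s(2) T by auto
      moreover have "{t \<in> topspace ?T. \<forall>i<n. (left_shift ^^ i) t \<in> g i} \<in> iterated_cover ?T left_shift \<U> n"
        unfolding iterated_cover_def using g by blast
      ultimately show "\<exists>U\<in>iterated_cover ?T left_shift \<U> n. W \<subseteq> U" by blast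
    qed
    also have "\<dots> \<le> card (prefixes (n + k))"
      unfolding \<W>_def by (intro card_image_le finite_prefixes)
    finally show ?thesis by simp
  qed
  then show "\<exists>k q. \<forall>n. min_subcover_card ?T (iterated_cover ?T left_shift \<U> n)
      \<le> card (prefixes (n + k)) * ((n + k) * q + 1)" by blast
qed

text \<open>Points in one member of the iterated first-letter partition share their first
  \<open>n\<close> letters, so a subcover needs a member for each word. General \<open>S\<close>
  serves the whole SFT as well as a single component.\<close>

lemma
  assumes S: "S \<subseteq> sft F"
  defines "\<U> \<equiv> (\<lambda>a. {s \<in> S. s 0 = a}) ` alph F"
  shows open_cover_first_letter: "open_cover (symbolic_space F S) \<U>"
    and card_words_le_first_letter: "left_shift ` S \<subseteq> S \<Longrightarrow>
      (\<And>w. w \<in> W \<Longrightarrow> length w = n \<and> (\<exists>s\<in>S. map s [0..<n] = w)) \<Longrightarrow>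
      card W \<le> min_subcover_card (symbolic_space F S) (iterated_cover (symbolic_space F S) left_shift \<U> n)"
proof -
  have T: "topspace (symbolic_space F S) = S" using S by (rule topspace_symbolic_space)
  have "\<Union>\<U> = S" using sftD(1) S by (auto simp: \<U>_def)
  moreover have "openin (symbolic_space F S) {s \<in> S. s 0 = a}" for a
    using S by (intro openin_cylinder[where k = 1]) auto
  ultimately show cover: "open_cover (symbolic_space F S) \<U>"
    by (auto simp: open_cover_def T \<U>_def)
  assume shift: "left_shift ` S \<subseteq> S"
    and W: "\<And>w. w \<in> W \<Longrightarrow> length w = n \<and> (\<exists>s\<in>S. map s [0..<n] = w)"
  show "card W \<le> min_subcover_card (symbolic_space F S) (iterated_cover (symbolic_space F S) left_shift \<U> n)"
    unfolding \<U>_def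
  proof (rule card_words_le_min_subcover_card[OF finite_alph])
    show "open_cover (symbolic_space F S) ((\<lambda>a. {s \<in> S. s 0 = a}) ` alph F)"
      using cover by (simp add: \<U>_def)
    show "left_shift ` topspace (symbolic_space F S) \<subseteq> topspace (symbolic_space F S)"
      using shift by (simp add: T)
    fix w assume "w \<in> W"
    with W obtain s where s: "s \<in> S" "map s [0..<n] = w" and n: "length w = n" by blast
    have "(left_shift ^^ i) s \<in> S" for i
      using s(1) shift by (induction i) auto
    moreover have "w ! i = s i" if "i < n" for i using s(2) that by auto
    ultimately show "length w = n \<and> (\<exists>x\<in>topspace (symbolic_space F S). \<forall>i<n. \<forall>a\<in>alph F.
        (left_shift ^^ i) x \<in> {s \<in> S. s 0 = a} \<longleftrightarrow> a = w ! i)"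
      using s(1) n by (intro conjI bexI[of _ s]) (auto simp: T left_shift_funpow)
  qed
qed

lemma left_shift_sft: "left_shift ` sft F \<subseteq> sft F"
  using sft_shift[of _ 1] by (auto simp: left_shift_def)

lemma word_growth_le_symbolic_entropy:
  "word_growth \<le> topological_entropy (symbolic_space F (sft F)) left_shift"
  unfolding word_growth_def
proof (rule le_topological_entropy)
  show "open_cover (symbolic_space F (sft F)) ((\<lambda>a. {s \<in> sft F. s 0 = a}) ` alph F)"
    by (rule open_cover_first_letter) simp
  show "card (prefixes n) \<le> min_subcover_card (symbolic_space F (sft F))
    (iterated_cover (symbolic_space F (sft F)) left_shift ((\<lambda>a. {s \<in> sft F. s 0 = a}) ` alph F) n)" for n
    by (rule card_words_le_first_letter) (auto simp: left_shift_sft[simplified image_subset_iff] prefixes_def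
      intro: left_shift_sft[THEN subsetD])
qed


section \<open>Letters with many loops\<close>

text \<open>The matrix as a relation with the alphabet built in, ready for transitive closures and
  \<open>successively\<close>.\<close>

definition step :: "'a \<Rightarrow> 'a \<Rightarrow> bool" where
  "step a b \<longleftrightarrow> a \<in> alph F \<and> b \<in> alph F \<and> D0 F b \<subseteq> R0 F a"

text \<open>The last letter repeats the first, so a loop of length \<open>n\<close> closes after
  \<open>n - 1\<close> steps.\<close>

definition loops :: "'a \<Rightarrow> nat \<Rightarrow> 'a list set" where
  "loops a n = {w \<in> prefixes n. w \<noteq> [] \<and> hd w = a \<and> last w = a}"

lemma sft_iff_step: "s \<in> sft F \<longleftrightarrow> (\<forall>n. step (s n) (s (Suc n)))"
  using sftD[of s] sftI[of s] unfolding step_def by blast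

lemma successively_prefixes:
  assumes "w \<in> prefixes n"
  shows "successively step w"
  using assms by (auto simp: prefixes_def successively_conv_nth sft_iff_step)

text \<open>If every letter had a bound \<open>K * exp g ^ n\<close> on its loops,
  \<open>card_words_le_of_loops\<close> would bound all words by a polynomial times
  \<open>exp g ^ n\<close>, and the growth rate would be at most \<open>g\<close>.\<close>

lemma exists_letter_with_many_loops:
  assumes g: "0 \<le> g" "ereal g < word_growth"
  shows "\<exists>a\<in>alph F. \<forall>K. \<exists>n. K * exp g ^ n < real (card (loops a n))"
proof (rule ccontr)
  assume "\<not> ?thesis"
  then have bound: "\<exists>K. \<forall>n. real (card (loops a n)) \<le> K * exp g ^ n" if "a \<in> alph F" for a
    using that by (meson not_le)
  define L where "L = (\<Union>n. prefixes n)"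
  have L: "{w \<in> L. length w = n} = prefixes n" for n
    using prefixes_subset_lists(1) by (auto simp: L_def)
  have loops: "{w \<in> L. length w = n \<and> w \<noteq> [] \<and> hd w = a \<and> last w = a} = loops a n" for a n
    using L[of n] by (auto simp: loops_def)
  have "\<exists>c\<ge>1. \<exists>d. \<forall>n. real (card {w \<in> L. length w = n}) \<le> c * (real n + 1) ^ d * exp g ^ n"
  proof (rule card_words_le_of_loops[OF finite_alph])
    show "set w \<subseteq> alph F" if "w \<in> L" for w using that prefixes_subset_lists(2) by (auto simp: L_def)
    show "v \<in> L" if "u @ v @ w \<in> L" for u v w
    proof -
      obtain s n where s: "s \<in> sft F" "u @ v @ w = map s [0..<n]"
        using \<open>u @ v @ w \<in> L\<close> by (auto simp: L_def prefixes_def)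
      have len: "length u + length v + length w = n" using arg_cong[OF s(2), of length] by simp
      have "v = map s [length u..<length u + length v]"
      proof (rule nth_equalityI)
        fix i assume i: "i < length v"
        then have "v ! i = (u @ v @ w) ! (length u + i)" by (simp add: nth_append)
        also have "\<dots> = s (length u + i)" using i len by (simp add: s(2))
        finally show "v ! i = map s [length u..<length u + length v] ! i" using i by simp
      qed simp
      then show ?thesis using map_in_prefixes[OF s(1), of "length u" "length v"] by (auto simp: L_def)
    qed
    show "1 \<le> exp g" using g by simp
  qed (unfold loops, rule bound)
  then obtain c d where c: "c \<ge> 1"
    and le: "\<And>n. real (card (prefixes n)) \<le> c * (real n + 1) ^ d * exp g ^ n"
    unfolding L by blast
  have "word_growth \<le> limsup (\<lambda>n. ereal (ln (exp g ^ n) / real n))"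
    unfolding word_growth_def
    by (rule log_growth_le[OF c]) (use le g in \<open>auto intro: one_le_power\<close>)
  also have "\<dots> \<le> limsup (\<lambda>n::nat. ereal g)"
    using g by (intro Limsup_mono always_eventually allI) (auto simp: ln_realpow divide_simps)
  also have "\<dots> = ereal g" by (simp add: Limsup_const)
  finally show False using g by simp
qed

text \<open>Without its repeated last letter a loop becomes a block that any other such block may
  follow. Nothing is lost, as that letter is known to be \<open>a\<close>; \<open>n \<ge> 2\<close>
  keeps the blocks nonempty.\<close>

lemma loop_blocks:
  assumes "n \<ge> 2"
  shows "card (butlast ` loops a n) = card (loops a n)" "finite (butlast ` loops a n)"
    and "\<And>b. b \<in> butlast ` loops a n \<Longrightarrow> length b = n - 1 \<and> hd b = a \<and> successively step (b @ [a])"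
proof -
  have snoc: "butlast w @ [a] = w" if "w \<in> loops a n" for w
    using that append_butlast_last_id[of w] by (auto simp: loops_def)
  then have "inj_on butlast (loops a n)" by (metis inj_onI)
  then show "card (butlast ` loops a n) = card (loops a n)" by (rule card_image)
  show "finite (butlast ` loops a n)"
    using finite_prefixes[of n] by (intro finite_imageI) (simp add: loops_def)
  fix b assume "b \<in> butlast ` loops a n"
  then obtain w where w: "w \<in> loops a n" "b = butlast w" by blast
  have len: "length w = n" using w(1) prefixes_subset_lists(1) by (auto simp: loops_def)
  have "b \<noteq> []" using len assms w(2) by (cases w rule: rev_cases) auto
  then have "hd b = hd w" using snoc[OF w(1)] w(2) by (metis hd_append2)
  then show "length b = n - 1 \<and> hd b = a \<and> successively step (b @ [a])"
    using w len snoc[OF w(1)] successively_prefixes[of w n] by (auto simp: loops_def)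
qed

lemma conc_in_sft:
  assumes m: "m > 0"
    and B: "\<And>b. b \<in> B \<Longrightarrow> length b = m \<and> hd b = a \<and> successively step (b @ [a])"
    and \<beta>: "\<And>i. \<beta> i \<in> B"
  shows "conc m \<beta> \<in> sft F"
  unfolding sft_iff_step
proof
  have ne: "\<beta> i \<noteq> []" for i using B[OF \<beta>[of i]] m by auto
  fix i show "step (conc m \<beta> i) (conc m \<beta> (Suc i))"
    by (rule conc_successive[OF m]) (use B[OF \<beta>] ne in \<open>auto simp: successively_append_iff\<close>)
qed

lemma concat_words:
  assumes B: "finite B" "B \<noteq> {}" "\<And>b. b \<in> B \<Longrightarrow> length b = m"
    and S: "\<And>\<beta>. (\<And>i. \<beta> i \<in> B) \<Longrightarrow> conc m \<beta> \<in> S"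
  shows "\<exists>W. card W = card B ^ k \<and> (\<forall>w\<in>W. length w = k * m \<and> (\<exists>s\<in>S. map s [0..<k * m] = w))"
proof (intro exI[of _ "concat ` {bs. set bs \<subseteq> B \<and> length bs = k}"] conjI ballI)
  show "card (concat ` {bs. set bs \<subseteq> B \<and> length bs = k}) = card B ^ k"
    using B by (intro card_concat_image) auto
  fix w assume "w \<in> concat ` {bs. set bs \<subseteq> B \<and> length bs = k}"
  then obtain bs where bs: "set bs \<subseteq> B" "length bs = k" "w = concat bs" by blast
  obtain b where b: "b \<in> B" using B(2) by blast
  \<comment> \<open>After the first \<open>k\<close> blocks any block may continue the
    sequence.\<close>
  define \<beta> where "\<beta> = (\<lambda>i. if i < k then bs ! i else b)"
  have \<beta>: "\<beta> i \<in> B" for i using bs b nth_mem[of i bs] by (auto simp: \<beta>_def)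
  have "map \<beta> [0..<k] = bs" using bs(2) by (intro nth_equalityI) (auto simp: \<beta>_def)
  then have "map (conc m \<beta>) [0..<k * m] = w" using prefix_conc[of \<beta> m k] B(3)[OF \<beta>] bs(3) by simp
  then show "\<exists>s\<in>S. map s [0..<k * m] = w" using S[of \<beta>] \<beta> by blast
  then show "length w = k * m" by auto
qed

section \<open>Recurrent sequences are determined by their trajectories\<close>


text \<open>Constructed backwards from the last letter: a point of \<open>D0\<close> lies in the
  range of the preceding letter, and its preimage lies in \<open>D0\<close> again, which keeps the
  induction going.\<close>

lemma exists_initial_trajectory:
  assumes "s \<in> sft F"
  shows "\<exists>x. (\<forall>i. x i \<in> {0..1}) \<and> x 0 \<in> D0 F (s 0) \<and> (\<forall>i<N. (x i, x (Suc i)) \<in> graph_of F (s i))"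
  using assms
proof (induction N arbitrary: s)
  case 0
  obtain y where y: "y \<in> D0 F (s 0)" using D0_nonempty[OF sftD(1)[OF 0]] by blast
  then have "y \<in> {0..1}" using D0_subset Dset_bounds sftD(1)[OF 0] by blast
  with y show ?case by (intro exI[of _ "\<lambda>_. y"]) simp
next
  case (Suc N)
  have "(\<lambda>i. s (Suc i)) \<in> sft F" using sft_shift[OF Suc.prems, of 1] by simp
  from Suc.IH[OF this] obtain x where x: "\<And>i. x i \<in> {0..1}" "x 0 \<in> D0 F (s (Suc 0))"
    "\<And>i. i < N \<Longrightarrow> (x i, x (Suc i)) \<in> graph_of F (s (Suc i))" by blast
  let ?a = "s 0"
  have a: "?a \<in> alph F" using sftD(1)[OF Suc.prems] .
  have R0: "x 0 \<in> R0 F ?a" using x(2) sftD(2)[OF Suc.prems, of 0] by blast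
  then have R: "x 0 \<in> Rset F ?a" using R0_subset[OF a] by blast
  have "\<exists>y. (y, x 0) \<in> graph_of F ?a"
  proof (cases "?a \<in> alph0 F")
    case True
    then obtain y where "y \<in> Dset F ?a" "x 0 = branch F ?a y" using R branch_image[OF True] by blast
    then show ?thesis using True by (auto simp: graph_of_def)
  next
    case False
    with a obtain p where "Dset F ?a = {p}" by (rule not_alph0E)
    then show ?thesis using False R by (auto simp: graph_of_def)
  qed
  then obtain y where y: "(y, x 0) \<in> graph_of F ?a" by blast
  then have "y \<in> D0 F ?a" using graph0_iff[OF a] graph0_subset[OF a] R0 by blast
  moreover from this have "y \<in> {0..1}" using D0_subset[OF a] Dset_bounds[OF a] by blast
  ultimately show ?case
    using x y by (intro exI[of _ "case_nat y x"]) (auto split: nat.splits simp: less_Suc_eq_0_disj)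
qed

text \<open>Finite trajectories give the finite intersection property in the compact cube. Points of
  the intersection satisfy only the closed conditions and may leave \<open>D0\<close>.\<close>

lemma exists_follows:
  assumes s: "s \<in> sft F"
  shows "\<exists>x. follows s x"
proof -
  have "{x :: nat \<Rightarrow> real. \<forall>n. x n \<in> {0..1}} \<inter> (\<Inter>n. {x. (x n, x (Suc n)) \<in> graph_of F (s n)}) \<noteq> {}"
  proof (rule compact_imp_fip_image[OF compact_unit_sequences])
    show "closed {x. (x n, x (Suc n)) \<in> graph_of F (s n)}" for n
      using sftD(1)[OF s] by (rule closed_follow_step)
    fix I :: "nat set" assume "finite I"
    then obtain N where N: "\<And>n. n \<in> I \<Longrightarrow> n < N" using finite_nat_set_iff_bounded by auto
    obtain x where "\<forall>i. x i \<in> {0..1}" "\<forall>i<N. (x i, x (Suc i)) \<in> graph_of F (s i)"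
      using exists_initial_trajectory[OF s] by blast
    then have "x \<in> {x. \<forall>n. x n \<in> {0..1}} \<inter> (\<Inter>n\<in>I. {x. (x n, x (Suc n)) \<in> graph_of F (s n)})"
      using N by simp
    then show "{x. \<forall>n. x n \<in> {0..1}} \<inter> (\<Inter>n\<in>I. {x. (x n, x (Suc n)) \<in> graph_of F (s n)}) \<noteq> {}"
      by blast
  qed
  then show ?thesis by (auto simp: follows_def)
qed

text \<open>Each coordinate is the image of the next under \<open>branch_inv\<close>. This carries
  the interval condition on avoiding words over to trajectories.\<close>

lemma follows_in_word_interval:
  assumes "s \<in> sft F" and "follows s x"
  shows "x 0 \<in> word_interval F (map s [0..<Suc n])"
  using assms
proof (induction n arbitrary: s x)
  case 0
  have "x 0 \<in> Dset F (s 0)"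
    using graph_subset[OF sftD(1)[OF 0(1)]] 0(2) unfolding follows_def by blast
  then show ?case by (simp add: word_interval_def)
next
  case (Suc n)
  let ?a = "s 0" and ?w = "map (\<lambda>i. s (Suc i)) [0..<Suc n]"
  have "map s [0..<Suc (Suc n)] = ?a # ?w"
    by (subst upt_conv_Cons) (simp_all add: map_Suc_upt[symmetric] del: upt_Suc)
  moreover have "word_interval F (?a # ?w) = branch_inv F ?a ` word_interval F ?w"
    by (simp add: word_interval_def)
  moreover have "x (Suc 0) \<in> word_interval F ?w"
    using Suc.IH[of "\<lambda>i. s (Suc i)" "\<lambda>i. x (Suc i)"] sft_shift[OF Suc.prems(1), of 1]
      follows_shift[OF Suc.prems(2), of 1] by simp
  moreover have "x 0 = branch_inv F ?a (x (Suc 0))"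
  proof -
    have a: "?a \<in> alph F" and g: "(x 0, x (Suc 0)) \<in> graph_of F ?a"
      using sftD(1)[OF Suc.prems(1)] Suc.prems(2) by (auto simp: follows_def)
    show ?thesis
    proof (cases "?a \<in> alph0 F")
      case True
      with g have "x 0 \<in> Dset F ?a" "x (Suc 0) = branch F ?a (x 0)" by (auto simp: graph_of_def)
      then show ?thesis using True branch_inj[OF True] by (simp add: branch_inv_def)
    next
      case False
      with a obtain p where "Dset F ?a = {p}" by (rule not_alph0E)
      then show ?thesis using False g by (auto simp: graph_of_def branch_inv_def)
    qed
  qed
  ultimately show ?case by (metis imageI)
qed

definition anchoring :: "'a list \<Rightarrow> bool" where
  "anchoring v \<longleftrightarrow> (\<forall>s\<in>cylinder F v. \<forall>x. follows s x \<longrightarrow> x 0 \<in> D0 F (s 0))"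

text \<open>The point \<open>x 0\<close> lies in the interval of \<open>s\<close>, hence outside
  \<open>Pset F\<close>, and passing from \<open>Dset\<close> to \<open>D0\<close> removes only
  partition points.\<close>

lemma anchoring_avoiding:
  assumes "avoiding_word F C v"
  shows "anchoring v"
  unfolding anchoring_def
proof (intro ballI allI impI)
  fix s x assume s: "s \<in> cylinder F v" and x: "follows s x"
  then have sft: "s \<in> sft F" by (simp add: cylinder_def)
  have "x 0 \<in> seq_interval F s"
    using follows_in_word_interval[OF sft x] by (simp add: seq_interval_def)
  then have "x 0 \<notin> Pset F" using assms s by (auto simp: avoiding_word_def)
  have "x 0 \<in> Dset F (s 0)"
    using graph_subset[OF sftD(1)[OF sft]] x unfolding follows_def by blast
  show "x 0 \<in> D0 F (s 0)"
    using sftD(1)[OF sft, of 0]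
  proof (cases rule: D0_cases)
    case (open_interval i)
    then have "pt F i \<in> Pset F" "pt F (Suc i) \<in> Pset F" by (auto simp: Pset_def)
    with \<open>x 0 \<notin> Pset F\<close> have "x 0 \<noteq> pt F i" "x 0 \<noteq> pt F (Suc i)" by auto
    with \<open>x 0 \<in> Dset F (s 0)\<close> open_interval show ?thesis by simp
  next
    case (point p)
    with \<open>x 0 \<in> Dset F (s 0)\<close> show ?thesis by simp
  qed
qed

lemma anchoring_letter:
  assumes "b \<notin> alph0 F"
  shows "anchoring [b]"
  unfolding anchoring_def
proof (intro ballI allI impI)
  fix s x assume "s \<in> cylinder F [b]" and x: "follows s x"
  then have sft: "s \<in> sft F" and "s 0 = b" by (auto simp: cylinder_def)
  then show "x 0 \<in> D0 F (s 0)"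
    using graph_subset[OF sftD(1)[OF sft], of "x 0" "x (Suc 0)" 0] x assms by (auto simp: follows_def D0_def)
qed

text \<open>A uniform waiting time \<open>l\<close> makes this a closed set; mere infinite
  recurrence is in general not a closed condition.\<close>

definition recurrent :: "'a list \<Rightarrow> nat \<Rightarrow> (nat \<Rightarrow> 'a) set" where
  "recurrent v l = {s \<in> sft F. \<forall>n. \<exists>j<l. \<forall>i<length v. s (n + j + i) = v ! i}"

lemma recurrent_subset: "recurrent v l \<subseteq> sft F"
  by (auto simp: recurrent_def)

lemma recurrent_shift:
  assumes "s \<in> recurrent v l"
  shows "(\<lambda>i. s (n + i)) \<in> recurrent v l"
proof -
  have "\<exists>j<l. \<forall>i<length v. s (n + (n' + j + i)) = v ! i" for n'
  proof -
    have "\<exists>j<l. \<forall>i<length v. s ((n + n') + j + i) = v ! i"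
      using assms unfolding recurrent_def by blast
    then show ?thesis by (simp add: add.assoc)
  qed
  then show ?thesis using assms sft_shift by (auto simp: recurrent_def)
qed

lemma closedin_recurrent: "closedin full_shift (recurrent v l)"
proof -
  define \<phi> where "\<phi> = (\<lambda>n s. \<exists>j<l. \<forall>i<length v. s (n + j + i) = v ! i)"
  have "\<phi> n s = \<phi> n t" if eq: "\<forall>i<n + l + length v. s i = t i" for n s t
  proof -
    have "(\<forall>i<length v. s (n + j + i) = v ! i) = (\<forall>i<length v. t (n + j + i) = v ! i)" if "j < l" for j
      using eq that by simp
    then show ?thesis unfolding \<phi>_def by blast
  qed
  then have "closedin full_shift {s \<in> topspace full_shift. \<forall>n. \<phi> n s}"
    by (intro closedin_full_shift_all_local) blast
  moreover have "recurrent v l = sft F \<inter> {s \<in> topspace full_shift. \<forall>n. \<phi> n s}"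
    using sft_subset_full_shift by (auto simp: recurrent_def \<phi>_def)
  ultimately show ?thesis using closedin_sft by (simp add: closedin_Int)
qed

lemma recurrent_anchored:
  assumes v: "anchoring v" and s: "s \<in> recurrent v l" and x: "follows s x"
  shows "\<exists>n>m. x n \<in> D0 F (s n)"
proof -
  obtain j where j: "\<forall>i<length v. s (Suc m + j + i) = v ! i"
    using s unfolding recurrent_def by blast
  let ?n = "Suc m + j"
  have "(\<lambda>i. s (?n + i)) \<in> sft F" using s recurrent_subset by (intro sft_shift) blast
  moreover have "map (\<lambda>i. s (?n + i)) [0..<length v] = v" using j by (intro nth_equalityI) auto
  ultimately have "(\<lambda>i. s (?n + i)) \<in> cylinder F v" by (simp add: cylinder_def)
  then have "x (?n + 0) \<in> D0 F (s (?n + 0))"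
    using v follows_shift[OF x, of ?n] unfolding anchoring_def by blast
  then show ?thesis by (intro exI[of _ ?n]) simp
qed

text \<open>Both sequences are anchored at some time after \<open>m\<close>, and anchoring reaches
  back to \<open>m\<close>. Among recurrent sequences the code is therefore a function of the
  trajectory.\<close>

lemma recurrent_determined:
  assumes v: "anchoring v" and s: "s \<in> recurrent v l" "follows s x" and t: "t \<in> recurrent v l" "follows t x"
  shows "s m = t m"
proof -
  obtain n n' where "n > m" "x n \<in> D0 F (s n)" "n' > m" "x n' \<in> D0 F (t n')"
    using recurrent_anchored[OF v s] recurrent_anchored[OF v t] by metis
  then show ?thesis
    using s t recurrent_subset by (intro follows_same_itinerary[of s x n m t n']) auto
qed

text \<open>The counterpart in \<open>X\<close> of a first-letter cylinder; for recurrent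
  \<open>Y\<close> with an anchoring word these sets are disjoint.\<close>

definition coded_from :: "(nat \<Rightarrow> 'a) set \<Rightarrow> 'a \<Rightarrow> (nat \<Rightarrow> real) set" where
  "coded_from Y a = {x. \<exists>s\<in>Y. s 0 = a \<and> follows s x}"

text \<open>The set is the projection of a closed set along the compact full shift.\<close>

lemma closedin_coded_from:
  assumes Y: "closedin full_shift Y" "Y \<subseteq> sft F"
  shows "closedin (trajectory_space F) (coded_from Y a)"
proof -
  let ?X = "trajectory_space F"
  let ?P = "prod_topology full_shift ?X"
  have T: "topspace ?X = trajectories F" by (simp add: trajectory_space_eq)
  \<comment> \<open>Splitting by the value \<open>b\<close> of the letter at \<open>n\<close> turns
    the condition at time \<open>n\<close> into a finite union of closed sets.\<close>
  define Z where "Z = (\<lambda>n. \<Union>b\<in>alph F. {z \<in> topspace ?P. fst z \<in> {s \<in> topspace full_shift. s n = b}} \<inter>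
      {z \<in> topspace ?P. snd z \<in> {x \<in> trajectories F. (x n, x (Suc n)) \<in> graph_of F b}})"
  define Z' where "Z' = {z \<in> topspace ?P. fst z \<in> Y \<inter> {s \<in> topspace full_shift. s 0 = a}}"
  have "closedin ?X {x \<in> trajectories F. (x n, x (Suc n)) \<in> graph_of F b}" if "b \<in> alph F" for b n
  proof -
    have "{x \<in> trajectories F. (x n, x (Suc n)) \<in> graph_of F b} =
        trajectories F \<inter> {x. (x n, x (Suc n)) \<in> graph_of F b}" by blast
    then show ?thesis
      unfolding trajectory_space_eq using closed_follow_step[OF that] by (simp add: closedin_closed_Int)
  qed
  moreover have "closedin full_shift {s \<in> topspace full_shift. s n = b}" for n b
    by (rule closedin_full_shift_local[where k = "Suc n"]) auto
  ultimately have "closedin ?P {z \<in> topspace ?P. fst z \<in> {s \<in> topspace full_shift. s n = b}}"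
    "closedin ?P {z \<in> topspace ?P. snd z \<in> {x \<in> trajectories F. (x n, x (Suc n)) \<in> graph_of F b}}"
    if "b \<in> alph F" for n b
    using that closedin_continuous_map_preimage[OF continuous_map_fst]
      closedin_continuous_map_preimage[OF continuous_map_snd] by blast+
  then have Z: "closedin ?P (Z n)" for n
    unfolding Z_def using finite_alph by (intro closedin_Union) auto
  have "closedin ?P Z'"
    unfolding Z'_def
    by (intro closedin_continuous_map_preimage[OF continuous_map_fst] closedin_Int Y(1)
      closedin_full_shift_local[where k = 1]) auto
  then have "closedin ?P (Z' \<inter> (\<Inter>n. Z n))"
    using Z by (intro closedin_Int closedin_Inter) auto
  moreover have "Z' \<inter> (\<Inter>n. Z n) = {(s, x). s \<in> Y \<and> s 0 = a \<and> follows s x}"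
  proof -
    have "(s, x) \<in> Z' \<inter> (\<Inter>n. Z n) \<longleftrightarrow> s \<in> Y \<and> s 0 = a \<and> follows s x" for s x
    proof
      assume "(s, x) \<in> Z' \<inter> (\<Inter>n. Z n)"
      then show "s \<in> Y \<and> s 0 = a \<and> follows s x" by (auto simp: Z_def Z'_def follows_def)
    next
      assume *: "s \<in> Y \<and> s 0 = a \<and> follows s x"
      then have "s \<in> sft F" using Y(2) by blast
      then have "x \<in> trajectories F" "s \<in> topspace full_shift"
        using * follows_trajectory sft_subset_full_shift by blast+
      then show "(s, x) \<in> Z' \<inter> (\<Inter>n. Z n)"
        using * sftD(1)[OF \<open>s \<in> sft F\<close>] by (auto simp: Z_def Z'_def T follows_def)
    qed
    then show ?thesis by auto
  qed
  ultimately have "closedin ?X (snd ` {(s, x). s \<in> Y \<and> s 0 = a \<and> follows s x})"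
    using Abstract_Topological_Spaces.closed_map_snd[OF compact_full_shift, of ?X]
    by (simp add: closed_map_def)
  moreover have "snd ` {(s, x). s \<in> Y \<and> s 0 = a \<and> follows s x} = coded_from Y a"
    by (force simp: coded_from_def)
  ultimately show ?thesis by simp
qed

lemma alph_nonempty: "alph F \<noteq> {}"
  using markov by (auto simp: markov_multimap_def)

text \<open>The sets \<open>coded_from\<close> are closed and disjoint but need neither be open nor
  cover \<open>X\<close>. Removing all of them except one gives open sets that do cover, and a
  trajectory with a recurrent code lies in just one of these.\<close>

lemma
  fixes l :: nat
  assumes v: "anchoring v"
  defines "V \<equiv> \<lambda>a. trajectories F - (\<Union>b\<in>alph F - {a}. coded_from (recurrent v l) b)"
  shows open_cover_coded: "open_cover (trajectory_space F) (V ` alph F)"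
    and card_recurrent_words_le: "(\<And>w. w \<in> W \<Longrightarrow> length w = n \<and> (\<exists>s\<in>recurrent v l. map s [0..<n] = w)) \<Longrightarrow>
      card W \<le> min_subcover_card (trajectory_space F) (iterated_cover (trajectory_space F) left_shift (V ` alph F) n)"
proof -
  let ?X = "trajectory_space F"
  have T: "topspace ?X = trajectories F" by (simp add: trajectory_space_eq)
  have disjoint: "a = b" if "x \<in> coded_from (recurrent v l) a" "x \<in> coded_from (recurrent v l) b" for a b x
    using that recurrent_determined[OF v] by (auto simp: coded_from_def)
  have "openin ?X (V a)" for a
    unfolding V_def T[symmetric]
    by (intro openin_diff openin_topspace closedin_Union)
      (auto simp: finite_alph intro!: closedin_coded_from closedin_recurrent recurrent_subset[THEN subsetD])
  moreover have "\<Union>(V ` alph F) = trajectories F"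
  proof
    show "\<Union>(V ` alph F) \<subseteq> trajectories F" by (auto simp: V_def)
    show "trajectories F \<subseteq> \<Union>(V ` alph F)"
    proof
      fix x assume x: "x \<in> trajectories F"
      obtain a where a: "a \<in> alph F" "\<And>b. b \<in> alph F \<Longrightarrow> x \<in> coded_from (recurrent v l) b \<Longrightarrow> b = a"
        using disjoint alph_nonempty by (metis ex_in_conv)
      then have "x \<in> V a" using x by (auto simp: V_def)
      with a(1) show "x \<in> \<Union>(V ` alph F)" by blast
    qed
  qed
  ultimately show cover: "open_cover ?X (V ` alph F)" by (auto simp: open_cover_def T)
  assume W: "\<And>w. w \<in> W \<Longrightarrow> length w = n \<and> (\<exists>s\<in>recurrent v l. map s [0..<n] = w)"
  show "card W \<le> min_subcover_card ?X (iterated_cover ?X left_shift (V ` alph F) n)"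
  proof (rule card_words_le_min_subcover_card[OF finite_alph cover])
    show "left_shift ` topspace ?X \<subseteq> topspace ?X" using left_shift_trajectories by (simp add: T)
    fix w assume "w \<in> W"
    with W obtain s where s: "s \<in> recurrent v l" "map s [0..<n] = w" and n: "length w = n" by blast
    have sft: "s \<in> sft F" using s(1) recurrent_subset by blast
    obtain x where x: "follows s x" using exists_follows[OF sft] by blast
    have X: "x \<in> trajectories F" using sft x by (rule follows_trajectory)
    have "(left_shift ^^ i) x \<in> V a \<longleftrightarrow> a = w ! i" if i: "i < n" and a: "a \<in> alph F" for i a
    proof -
      have wi: "w ! i = s i" using s(2) i by auto
      have "(left_shift ^^ i) x \<in> coded_from (recurrent v l) (s i)"
        unfolding coded_from_def left_shift_funpow
        using recurrent_shift[OF s(1), of i] follows_shift[OF x, of i]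
        by (intro CollectI bexI[of _ "\<lambda>j. s (i + j)"]) auto
      moreover have "(left_shift ^^ i) x \<in> trajectories F"
        using X left_shift_trajectories by (induction i) auto
      moreover have "b = s i" if "(left_shift ^^ i) x \<in> coded_from (recurrent v l) b" for b
        using disjoint that calculation(1) by blast
      ultimately show ?thesis
        using sftD(1)[OF sft, of i] unfolding V_def wi by blast
    qed
    then show "length w = n \<and> (\<exists>x\<in>topspace ?X. \<forall>i<n. \<forall>a\<in>alph F. (left_shift ^^ i) x \<in> V a \<longleftrightarrow> a = w ! i)"
      using n X by (auto simp: T)
  qed
qed

section \<open>Irreducible components\<close>


definition component_of :: "'a \<Rightarrow> 'a set" where
  "component_of a = {b \<in> alph F. step\<^sup>*\<^sup>* a b \<and> step\<^sup>*\<^sup>* b a}"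

lemma reachable_transition_graph:
  "u \<rightarrow>\<^sup>*\<^bsub>transition_graph F\<^esub> v \<longleftrightarrow> u \<in> alph F \<and> step\<^sup>*\<^sup>* u v"
proof -
  have ends: "(a, b) \<in> arcs_ends (transition_graph F) \<longleftrightarrow> step a b" for a b
    by (force simp: arcs_ends_conv transition_graph_def step_def transition_def)
  have verts: "verts (transition_graph F) = alph F" by (simp add: transition_graph_def)
  show ?thesis
    unfolding reachable_def verts
  proof (intro iffI; (elim conjE)?)
    assume "(u, v) \<in> rtrancl_on (alph F) (arcs_ends (transition_graph F))"
    then show "u \<in> alph F \<and> step\<^sup>*\<^sup>* u v"
      by (induction rule: rtrancl_on_induct) (auto simp: ends intro: rtranclp.rtrancl_into_rtrancl)
  next
    assume "u \<in> alph F" "step\<^sup>*\<^sup>* u v"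
    from this(2) show "(u, v) \<in> rtrancl_on (alph F) (arcs_ends (transition_graph F))"
    proof (induction rule: rtranclp_induct)
      case base
      show ?case using \<open>u \<in> alph F\<close> by simp
    next
      case (step y z)
      then have "(y, z) \<in> arcs_ends (transition_graph F)" "z \<in> alph F"
        using ends by (simp, simp add: step_def)
      with step.IH show ?case by (rule rtrancl_on_into_rtrancl_on)
    qed
  qed
qed

lemma irreducible_component_of:
  assumes "a \<in> alph F"
  shows "irreducible_component F (component_of a)"
proof -
  interpret wf_digraph "transition_graph F"
    by unfold_locales (auto simp: transition_graph_def)
  have "scc_of a \<in> sccs_verts"
    using assms by (intro scc_of_in_sccs_verts) (simp add: transition_graph_def)
  moreover have "scc_of a = component_of a"
    using assms by (auto simp: scc_of_def component_of_def reachable_transition_graph)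
  ultimately show ?thesis by (simp add: irreducible_component_def sccs_verts_conv)
qed

lemma loop_blocks_in_component:
  assumes "n \<ge> 2" "b \<in> butlast ` loops a n" "c \<in> set b"
  shows "c \<in> component_of a"
proof -
  have b: "length b = n - 1" "hd b = a" "successively step (b @ [a])"
    using loop_blocks(3)[OF assms(1,2)] by auto
  then have "b \<noteq> []" using assms(1) by auto
  obtain i where i: "i < length b" "c = b ! i" using assms(3) by (metis in_set_conv_nth)
  have "step\<^sup>*\<^sup>* ((b @ [a]) ! 0) ((b @ [a]) ! i)" "step\<^sup>*\<^sup>* ((b @ [a]) ! i) ((b @ [a]) ! length b)"
    by (rule rtranclp_of_successively[OF b(3)]; use i in simp)+
  moreover have "(b @ [a]) ! 0 = a" using b(2) \<open>b \<noteq> []\<close> by (simp add: nth_append hd_conv_nth)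
  moreover have "(b @ [a]) ! i = c" "(b @ [a]) ! length b = a" using i by (simp_all add: nth_append)
  moreover have "c \<in> alph F"
    using assms(2,3) prefixes_subset_lists(2)[of _ n] by (auto simp: loops_def dest!: in_set_butlastD)
  ultimately show ?thesis by (simp add: component_of_def)
qed

text \<open>Two loops of equal length concatenate freely, which yields at least \<open>2 ^ k\<close>
  words of length \<open>k * (n - 1)\<close>, and all their letters stay in the component.\<close>

lemma positive_entropy_component_of:
  assumes a: "a \<in> alph F" and n: "n \<ge> 2" and loops: "card (loops a n) \<ge> 2"
  shows "positive_entropy_component F (component_of a)"
proof -
  define B where "B = butlast ` loops a n"
  define C where "C = component_of a"
  have B: "card B = card (loops a n)" "finite B"
    "\<And>b. b \<in> B \<Longrightarrow> length b = n - 1 \<and> hd b = a \<and> successively step (b @ [a])"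
    using loop_blocks[OF n] unfolding B_def by blast+
  have "B \<noteq> {}" using B(1) loops by auto
  have S: "sft_on F C \<subseteq> sft F" by (auto simp: sft_on_def)
  have conc: "conc (n - 1) \<beta> \<in> sft_on F C" if \<beta>: "\<And>i. \<beta> i \<in> B" for \<beta>
  proof -
    have "conc (n - 1) \<beta> i \<in> set (\<beta> (i div (n - 1)))" for i
      using n B(3)[OF \<beta>] by (intro conc_in_set) auto
    then have "conc (n - 1) \<beta> i \<in> C" for i
      using loop_blocks_in_component[OF n] \<beta> unfolding B_def C_def by blast
    moreover have "conc (n - 1) \<beta> \<in> sft F"
      using n by (intro conc_in_sft[OF _ B(3) \<beta>]) auto
    ultimately show ?thesis by (simp add: sft_on_def)
  qed
  have "ereal (ln (real (card B)) / real (n - 1)) \<le> topological_entropy (symbolic_space F (sft_on F C)) left_shift"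
  proof (rule ln_div_le_topological_entropy)
    show "open_cover (symbolic_space F (sft_on F C)) ((\<lambda>a. {s \<in> sft_on F C. s 0 = a}) ` alph F)"
      using S by (rule open_cover_first_letter)
    show "n - 1 > 0" "card B > 0" using n loops B(1) by auto
    fix k
    obtain W where W: "card W = card B ^ k"
      "\<forall>w\<in>W. length w = k * (n - 1) \<and> (\<exists>s\<in>sft_on F C. map s [0..<k * (n - 1)] = w)"
      using concat_words[OF B(2) \<open>B \<noteq> {}\<close>, of "n - 1" "sft_on F C" k] B(3) conc by blast
    have "left_shift ` sft_on F C \<subseteq> sft_on F C"
      using left_shift_sft by (auto simp: sft_on_def) (auto simp: left_shift_def)
    from card_words_le_first_letter[OF S this, of W "k * (n - 1)"] W
    show "card B ^ k \<le> min_subcover_card (symbolic_space F (sft_on F C)) (iterated_cover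
        (symbolic_space F (sft_on F C)) left_shift ((\<lambda>a. {s \<in> sft_on F C. s 0 = a}) ` alph F) (k * (n - 1)))"
      by simp
  qed
  moreover have "0 < ln (real (card B)) / real (n - 1)"
    using n loops B(1) by (intro divide_pos_pos) auto
  ultimately have "topological_entropy (symbolic_space F (sft_on F C)) left_shift > 0"
    by (metis ereal_less(2) order_less_le_trans)
  then show ?thesis
    using irreducible_component_of[OF a] by (simp add: positive_entropy_component_def C_def)
qed

lemma language_successively:
  assumes "v \<in> language F"
  shows "v \<noteq> []" "successively step v"
  using assms
  by (auto simp: language_def words_of_index_def successively_conv_nth step_def transition_def
      subset_iff split: if_splits)

lemma connecting_block:
  assumes v: "v \<in> language_on F (component_of a)" and loop: "step\<^sup>+\<^sup>+ a a"
  shows "\<exists>u w. hd (u @ v @ w) = a \<and> successively step ((u @ v @ w) @ [a])"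
proof -
  have lang: "v \<noteq> []" "successively step v" and C: "set v \<subseteq> component_of a"
    using v language_successively by (auto simp: language_on_def)
  have "hd v \<in> component_of a" "last v \<in> component_of a" using C lang(1) by auto
  \<comment> \<open>The loop at \<open>a\<close> makes these paths nonempty, even if
    \<open>v\<close> begins or ends with \<open>a\<close>.\<close>
  then have "step\<^sup>+\<^sup>+ a (hd v)" "step\<^sup>+\<^sup>+ (last v) a"
    using loop by (auto simp: component_of_def intro: tranclp_rtranclp_tranclp rtranclp_tranclp_tranclp)
  then obtain l l' where l: "successively step (a # l @ [hd v])" "successively step (last v # l' @ [a])"
    using successively_of_tranclp by metis
  have "successively step (xs @ [hd v]) \<Longrightarrow> successively step (last v # ys) \<Longrightarrow>
      successively step (xs @ v @ ys)" for xs ys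
    using lang by (auto simp: successively_append_iff successively_Cons)
  from this[of "a # l" "l' @ [a]"] have "successively step ((a # l) @ v @ (l' @ [a]))"
    using l by simp
  then show ?thesis by (intro exI[of _ "a # l"] exI[of _ l']) simp
qed

lemma anchoring_word_in_component:
  assumes "\<And>C. positive_entropy_component F C \<Longrightarrow> C \<subseteq> alph0 F \<Longrightarrow> \<exists>u. avoiding_word F C u"
    and C: "positive_entropy_component F (component_of a)"
  shows "\<exists>v\<in>language_on F (component_of a). anchoring v"
proof (cases "component_of a \<subseteq> alph0 F")
  case True
  with assms obtain v where "avoiding_word F (component_of a) v" by blast
  then show ?thesis using anchoring_avoiding by (auto simp: avoiding_word_def)
next
  case False
  then obtain b where b: "b \<in> component_of a" "b \<notin> alph0 F" by blast
  then have "[b] \<in> words_of_index F 0" by (simp add: words_of_index_def component_of_def)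
  then have "[b] \<in> language_on F (component_of a)" using b by (auto simp: language_on_def language_def)
  then show ?thesis using anchoring_letter[OF b(2)] by blast
qed

section \<open>The entropy of the trajectory space is at least the word growth\<close>

lemma conc_recurrent:
  assumes m: "m > 0"
    and B: "\<And>b. b \<in> B \<Longrightarrow> length b = m \<and> hd b = a \<and> successively step (b @ [a])"
    and occ: "\<And>b i. b \<in> B \<Longrightarrow> i < length v \<Longrightarrow> b ! (p + i) = v ! i" and p: "p + length v \<le> m" "v \<noteq> []"
    and \<beta>: "\<And>i. \<beta> i \<in> B"
  shows "conc m \<beta> \<in> recurrent v (2 * m)"
proof -
  have "\<exists>j<2 * m. \<forall>i<length v. conc m \<beta> (n + j + i) = v ! i" for n
  proof (intro exI conjI allI impI)
    \<comment> \<open>The next block starts at most \<open>m\<close> places after \<open>n\<close>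
      and contains \<open>v\<close> at an offset below \<open>m\<close>, hence the gap bound
      \<open>2 * m\<close>.\<close>
    define k where "k = Suc (n div m)"
    define j where "j = k * m + p - n"
    have "n < k * m" using dividend_less_div_times[OF m, of n] by (simp add: k_def)
    moreover have "n div m * m \<le> n" by simp
    moreover have "p < m" using p by (cases v) auto
    ultimately show "j < 2 * m" unfolding j_def k_def mult_Suc by linarith
    fix i assume i: "i < length v"
    obtain r where r: "r = p + i" "r < m" using i p by simp
    have "n + j + i = k * m + r" using \<open>n < k * m\<close> r by (simp add: j_def)
    moreover have "conc m \<beta> (k * m + r) = \<beta> k ! r" using r(2) by (simp add: conc_def)
    ultimately have "conc m \<beta> (n + j + i) = \<beta> k ! (p + i)" by (simp only: r(1))
    then show "conc m \<beta> (n + j + i) = v ! i" using occ[OF \<beta> i] by simp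
  qed
  moreover have "conc m \<beta> \<in> sft F" by (rule conc_in_sft[OF m B \<beta>])
  ultimately show ?thesis by (simp add: recurrent_def)
qed

text \<open>Appending the same \<open>u @ v @ w\<close> to every loop block preserves their number
  and a common length, and plants \<open>v\<close> at a fixed offset in each block.\<close>

lemma ln_loops_le_trajectory_entropy:
  assumes n: "n \<ge> 2" and loops: "loops a n \<noteq> {}" and v: "v \<noteq> []" "anchoring v"
    and uvw: "hd (u @ v @ w) = a" "successively step ((u @ v @ w) @ [a])"
  shows "ereal (ln (real (card (loops a n))) / real (n - 1 + length (u @ v @ w)))
     \<le> topological_entropy (trajectory_space F) left_shift"
proof -
  define B0 where "B0 = butlast ` loops a n"
  have B0: "card B0 = card (loops a n)" "finite B0"
    "\<And>b. b \<in> B0 \<Longrightarrow> length b = n - 1 \<and> hd b = a \<and> successively step (b @ [a])"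
    using loop_blocks[OF n] unfolding B0_def by blast+
  define B where "B = (\<lambda>b. b @ u @ v @ w) ` B0"
  define m where "m = n - 1 + length (u @ v @ w)"
  have "B0 \<noteq> {}" using loops by (simp add: B0_def)
  then have fin: "finite B" "B \<noteq> {}" using B0(2) by (auto simp: B_def)
  have cardB: "card B = card (loops a n)"
    unfolding B_def B0(1)[symmetric] by (intro card_image inj_onI) simp
  have m: "m > 0" using n by (simp add: m_def)
  have block: "length b = m \<and> hd b = a \<and> successively step (b @ [a])" if b: "b \<in> B" for b
  proof -
    obtain b0 where b0: "b0 \<in> B0" "b = b0 @ u @ v @ w" using b by (auto simp: B_def)
    have "b0 \<noteq> []" using B0(3)[OF b0(1)] n by auto
    then show ?thesis
      using B0(3)[OF b0(1)] b0(2) uvw v(1)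
      by (auto simp: m_def successively_append_iff hd_append split: if_splits)
  qed
  define p where "p = n - 1 + length u"
  have occ: "b ! (p + i) = v ! i" if b: "b \<in> B" and i: "i < length v" for b i
  proof -
    obtain b0 where b0: "b0 \<in> B0" "b = b0 @ u @ v @ w" using b by (auto simp: B_def)
    then show ?thesis using B0(3)[OF b0(1)] i by (simp add: p_def nth_append)
  qed
  have p: "p + length v \<le> m" by (simp add: p_def m_def)
  define Y where "Y = recurrent v (2 * m)"
  have conc: "conc m \<beta> \<in> Y" if "\<And>i. \<beta> i \<in> B" for \<beta>
    unfolding Y_def using conc_recurrent[OF m block occ p v(1)] that by blast
  define V where "V = (\<lambda>c. trajectories F - (\<Union>b\<in>alph F - {c}. coded_from Y b))"
  have "ereal (ln (real (card B)) / real m) \<le> topological_entropy (trajectory_space F) left_shift"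
  proof (rule ln_div_le_topological_entropy[OF _ m])
    show "open_cover (trajectory_space F) (V ` alph F)"
      unfolding V_def Y_def by (rule open_cover_coded[OF v(2)])
    show "card B > 0" using fin by (simp add: card_gt_0_iff)
    fix k
    obtain W where W: "card W = card B ^ k" "\<forall>w\<in>W. length w = k * m \<and> (\<exists>s\<in>Y. map s [0..<k * m] = w)"
      using concat_words[OF fin, of m Y k] block conc by blast
    then show "card B ^ k \<le> min_subcover_card (trajectory_space F)
        (iterated_cover (trajectory_space F) left_shift (V ` alph F) (k * m))"
      using card_recurrent_words_le[OF v(2), of W "k * m" "2 * m"] unfolding V_def Y_def by simp
  qed
  then show ?thesis by (simp add: cardB m_def)
qed

lemma word_growth_le_trajectory_entropy:
  assumes avoiding: "\<And>C. positive_entropy_component F C \<Longrightarrow> C \<subseteq> alph0 F \<Longrightarrow> \<exists>u. avoiding_word F C u"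
    and pos: "word_growth > 0"
  shows "word_growth \<le> topological_entropy (trajectory_space F) left_shift"
proof (rule ccontr)
  let ?h = "topological_entropy (trajectory_space F) left_shift"
  assume "\<not> word_growth \<le> ?h"
  \<comment> \<open>The maximum with 0 secures \<open>g > 0\<close>, so that
    \<open>exp g ^ n \<ge> 1\<close>.\<close>
  then have "max 0 ?h < word_growth" using pos by simp
  then obtain g where g: "max 0 ?h < ereal g" "ereal g < word_growth"
    using ereal_dense2 by blast
  then have "0 < g" "?h < ereal g" by simp_all
  then obtain a where a: "a \<in> alph F" and many: "\<And>K. \<exists>n. K * exp g ^ n < real (card (loops a n))"
    using exists_letter_with_many_loops[of g] g by auto
  have large: "\<exists>n\<ge>2. K * exp g ^ n < real (card (loops a n)) \<and> card (loops a n) \<ge> 2" if K: "K \<ge> 1" for K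
  proof -
    obtain n where n: "K * exp g ^ n < real (card (loops a n))" using many by blast
    have "1 * 1 \<le> K * exp g ^ n" using K \<open>0 < g\<close> by (intro mult_mono one_le_power) auto
    then have two: "card (loops a n) \<ge> 2" using n by linarith
    have "n \<ge> 2"
    proof (rule ccontr)
      assume "\<not> n \<ge> 2"
      have "w = [a]" if w: "w \<in> loops a n" for w
      proof -
        have "length w \<le> 1" "w \<noteq> []" "hd w = a"
          using w \<open>\<not> n \<ge> 2\<close> prefixes_subset_lists(1)[of w n] by (auto simp: loops_def)
        then show ?thesis by (cases w) auto
      qed
      then have "loops a n \<subseteq> {[a]}" by blast
      then have "card (loops a n) \<le> 1" using card_mono[of "{[a]}" "loops a n"] by simp
      then show False using two by simp
    qed
    with n two show ?thesis by blast
  qed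
  obtain n0 where n0: "n0 \<ge> 2" "card (loops a n0) \<ge> 2" using large[of 1] by blast
  have C: "positive_entropy_component F (component_of a)"
    using a n0 by (rule positive_entropy_component_of)
  obtain v where v: "v \<in> language_on F (component_of a)" "anchoring v"
    using anchoring_word_in_component[OF avoiding C] by blast
  have "v \<noteq> []" using v(1) language_successively(1) by (auto simp: language_on_def)
  have "step\<^sup>+\<^sup>+ a a"
  proof -
    obtain b where "b \<in> butlast ` loops a n0" using n0(2) by fastforce
    then have b: "length b = n0 - 1" "hd b = a" "successively step (b @ [a])"
      using loop_blocks(3)[OF n0(1)] by auto
    then obtain b' where "b = a # b'" using n0(1) by (cases b) auto
    then have "step a ((b @ [a]) ! 1)" "step\<^sup>*\<^sup>* ((b @ [a]) ! 1) ((b @ [a]) ! length b)"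
      using successively_nth[OF b(3), of 0] by (simp, intro rtranclp_of_successively[OF b(3)]) simp_all
    then show ?thesis by (simp add: nth_append rtranclp_into_tranclp2)
  qed
  then obtain u w where uvw: "hd (u @ v @ w) = a" "successively step ((u @ v @ w) @ [a])"
    using connecting_block[OF v(1)] by blast
  define c where "c = length (u @ v @ w)"
  \<comment> \<open>The length \<open>c\<close> of the connecting block is fixed before
    \<open>n\<close>, so the constant \<open>exp g ^ c\<close> can compensate for it.\<close>
  obtain n where n: "n \<ge> 2" "exp g ^ c * exp g ^ n < real (card (loops a n))" "card (loops a n) \<ge> 2"
    using large[of "exp g ^ c"] \<open>0 < g\<close> by auto
  have "real (n - 1 + c) * g \<le> real (c + n) * g"
    using \<open>0 < g\<close> by (intro mult_right_mono) auto
  also have "\<dots> = ln (exp g ^ c * exp g ^ n)"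
    by (simp add: ln_realpow flip: power_add)
  also have "\<dots> < ln (real (card (loops a n)))"
    using n(2,3) by (subst ln_less_cancel_iff) auto
  finally have "g < ln (real (card (loops a n))) / real (n - 1 + c)"
    using n(1) by (simp add: field_simps)
  then have "ereal g < ereal (ln (real (card (loops a n))) / real (n - 1 + c))" by simp
  also have "\<dots> \<le> ?h"
    unfolding c_def using n \<open>v \<noteq> []\<close> v(2) uvw by (intro ln_loops_le_trajectory_entropy) auto
  finally show False using \<open>?h < ereal g\<close> by simp
qed

lemma trajectory_entropy_le_word_growth:
  "topological_entropy (trajectory_space F) left_shift \<le> word_growth"
  by (rule topological_entropy_le_word_growth[OF trajectory_cover_bound])

end

theorem corollary1p2:
  fixes F :: "'a multimap_data"
  assumes "class_F F"
  shows "topological_entropy (trajectory_space F) left_shift =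
         topological_entropy (symbolic_space F (sft F)) left_shift"
proof -
  interpret proper_markov_multimap F
    using assms by unfold_locales (simp_all add: class_F_def)
  have eq: "topological_entropy (symbolic_space F (sft F)) left_shift = word_growth"
    using symbolic_entropy_le_word_growth word_growth_le_symbolic_entropy by (rule antisym)
  \<comment> \<open>By \<open>eq\<close>, the positive entropy of the SFT gives
    \<open>word_growth > 0\<close>.\<close>
  have "word_growth \<le> topological_entropy (trajectory_space F) left_shift"
    by (rule word_growth_le_trajectory_entropy) (use assms eq in \<open>auto simp: class_F_def\<close>)
  with trajectory_entropy_le_word_growth eq show ?thesis by (metis antisym)
qed

end
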